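(* Let $p(x)\in\mathbf{Q}(x)\setminus\mathbf{Q}$ be nonconstant without pole at $x=0$; let $x(t)\in t+t^2\mathbf{Q}[\![t]\!]$ with $p(x(t))\in\mathbf{Z}[\![t]\!]$; let $\varphi:\overline{D(0,1)}\to\mathbf{C}$ be holomorphic on a neighborhood of the closed unit disc with $\varphi(0)=0$, $|\varphi'(0)|>1$ and $p\circ\varphi\in\mathcal{O}(\overline{D(0,1)})$. Let $f_1,\dots,f_m\in\mathbf{Q}[\![x]\!]$ be linearly independent over $\mathbf{Q}(p(x))$ with $f_i(x(t))\in\mathbf{Z}[\![t]\!]$ and $f_i\circ\varphi\in\mathcal{O}(\overline{D(0,1)})$ for all $i$. Let moreover $h:\overline{D(0,1)}\to\mathbf{C}$ be any function holomorphic on a neighborhood of the closed unit disc with $h(0)=1$. Then $$m\le e\,\frac{\max\big\{\sup_{\mathbf{T}}\log|h|,\ \sup_{\mathbf{T}}\log|h\cdot(p\circ\varphi)|\big\}}{\log|\varphi'(0)|},$$ and each $f_i$ is algebraic over $\mathbf{Q}(x)$.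
   Context: $\mathcal{O}(\overline{D(0,1)})$ denotes the ring of power series converging on a neighborhood of the closed unit disc; $f_i\circ\varphi$ is the formal composite $f_i(\varphi(z))\in\mathbf{C}[\![z]\!]$. $\mathbf{T}$ is the unit circle; $e$ is Euler's number. *)

theory Defs
  imports
    "HOL-Complex_Analysis.Complex_Analysis"
    "HOL-Computational_Algebra.Computational_Algebra"
begin

text \<open>The field \<open>\<rat>(x)\<close> is \<^typ>\<open>rat poly fract\<close>; it is embedded into \<^typ>\<open>rat fls\<close>
  by Laurent expansion at \<open>x = 0\<close>.\<close>

definition ratfun_to_fls :: "'a::field poly fract \<Rightarrow> 'a fls" where
  "ratfun_to_fls r =
     (THE g. \<exists>a b. b \<noteq> 0 \<and> r = Fraction_Field.Fract a b \<and>
        g = fps_to_fls (fps_of_poly a) / fps_to_fls (fps_of_poly b))"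

lemma ratfun_to_fls_Fract:
  fixes a b :: "'a::field poly"
  assumes "b \<noteq> 0"
  shows "ratfun_to_fls (Fraction_Field.Fract a b) =
           fps_to_fls (fps_of_poly a) / fps_to_fls (fps_of_poly b)"
  unfolding ratfun_to_fls_def
proof (rule the_equality, goal_cases)
  case 1
  show ?case using assms by blast
next
  case (2 g)
  then obtain c d where *: "d \<noteq> 0" "Fraction_Field.Fract a b = Fraction_Field.Fract c d"
    and g: "g = fps_to_fls (fps_of_poly c) / fps_to_fls (fps_of_poly d)"
    by blast
  then have "a * d = c * b"
    using assms by (simp add: eq_fract)
  then have "fps_to_fls (fps_of_poly a) * fps_to_fls (fps_of_poly d) =
        fps_to_fls (fps_of_poly c) * fps_to_fls (fps_of_poly b)"
    by (metis fls_times_fps_to_fls fps_of_poly_mult)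
  with * assms show ?case
    by (simp add: g frac_eq_eq fps_to_fls_eq_0_iff)
qed

definition ratfun_const :: "'a::field \<Rightarrow> 'a poly fract" where
  "ratfun_const c = Fraction_Field.Fract [:c:] 1"

definition ratfun_regular_at_0 :: "'a::field poly fract \<Rightarrow> bool" where
  "ratfun_regular_at_0 p \<longleftrightarrow> (\<exists>a b. p = Fraction_Field.Fract a b \<and> poly b 0 \<noteq> 0)"

text \<open>The power series expansion at \<open>0\<close> (meaningful only if there is no pole at \<open>0\<close>,
  since the principal part is dropped).\<close>

definition ratfun_to_fps :: "'a::field poly fract \<Rightarrow> 'a fps" where
  "ratfun_to_fps p = fls_regpart (ratfun_to_fls p)"

lemma ratfun_to_fps_Fract:
  assumes "poly b 0 \<noteq> 0"
  shows "ratfun_to_fps (Fraction_Field.Fract a b) = fps_of_poly a / fps_of_poly b"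
proof -
  have "fps_of_poly b $ 0 \<noteq> 0" "b \<noteq> 0"
    using assms by (auto simp: poly_0_coeff_0)
  then show ?thesis
    by (simp add: ratfun_to_fps_def ratfun_to_fls_Fract fls_inverse_fps_to_fls
        fls_times_fps_to_fls [symmetric] divide_inverse fps_divide_unit)
qed

text \<open>The subfield \<open>k(p)\<close> of \<open>k(x)\<close> generated by \<open>p\<close> over the constants.\<close>

definition ratfun_subfield :: "'a::field poly fract \<Rightarrow> 'a poly fract set" where
  "ratfun_subfield p =
     {poly (map_poly ratfun_const A) p / poly (map_poly ratfun_const B) p | A B.
        poly (map_poly ratfun_const B) p \<noteq> 0}"

text \<open>Linear independence of the finite family \<open>(f i)\<close>, \<open>i \<in> I\<close>, over a subfield \<open>K\<close> of \<open>k(x)\<close>,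
  inside the \<open>k(x)\<close>-vector space of Laurent series.\<close>

definition fps_lin_indep_over ::
    "'a::field poly fract set \<Rightarrow> 'b set \<Rightarrow> ('b \<Rightarrow> 'a fps) \<Rightarrow> bool" where
  "fps_lin_indep_over K I f \<longleftrightarrow>
     (\<forall>c. (\<forall>i\<in>I. c i \<in> K) \<and> (\<Sum>i\<in>I. ratfun_to_fls (c i) * fps_to_fls (f i)) = 0
          \<longrightarrow> (\<forall>i\<in>I. c i = 0))"

definition fps_algebraic :: "'a::field fps \<Rightarrow> bool" where
  "fps_algebraic f \<longleftrightarrow>
     (\<exists>P :: 'a poly fract poly. P \<noteq> 0 \<and> poly (map_poly ratfun_to_fls P) (fps_to_fls f) = 0)"

definition fps_int_coeffs :: "rat fps \<Rightarrow> bool" where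
  "fps_int_coeffs f \<longleftrightarrow> (\<forall>n. fps_nth f n \<in> \<int>)"

definition fps_complex_of_rat :: "rat fps \<Rightarrow> complex fps" where
  "fps_complex_of_rat f = Abs_fps (\<lambda>n. of_rat (fps_nth f n))"

definition formal_comp :: "rat fps \<Rightarrow> (complex \<Rightarrow> complex) \<Rightarrow> complex fps" where
  "formal_comp f \<phi> = fps_complex_of_rat f oo fps_expansion \<phi> 0"

definition O_closed_disc :: "complex fps set" where
  "O_closed_disc = {F. fps_conv_radius F > 1}"

definition elog :: "real \<Rightarrow> ereal" where
  "elog r = (if r = 0 then -\<infinity> else ereal (ln r))"

end

theory Submission
  imports Defs "HOL-Real_Asymp.Real_Asymp"
begin

text \<open>
  Following Andre, Calegari, Dimitrov and Tang, one works with auxiliary functions in many variables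
  \<open>F(x\<^sub>1,\<dots>,x\<^sub>d) = \<Sum> a\<^sub>i\<^sub>,\<^sub>k \<Prod>\<^sub>s p(x\<^sub>s)\<^bsup>k\<^sub>s\<^esup> f\<^bsub>i\<^sub>s\<^esub>(x\<^sub>s)\<close> with \<open>0 \<le> k\<^sub>s < D\<close> and small integers \<open>a\<^sub>i\<^sub>,\<^sub>k\<close>.
  There are \<open>(mD)\<^sup>d\<close> parameters and about \<open>(e\<alpha>/d)\<^sup>d\<close> monomials of total degree below \<open>\<alpha>\<close>, so \<open>F\<close> can be
  made to vanish to order \<open>\<alpha>\<close> close to \<open>dmD/e\<close>, and for large \<open>d\<close> the parameters still outnumber the
  equations by any prescribed factor, which keeps \<open>log |a\<^sub>i\<^sub>,\<^sub>k|\<close> negligible. A nonzero coefficient of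
  lowest total degree \<open>\<beta> \<ge> \<alpha>\<close> is the same in the coordinates \<open>x\<close> and \<open>t\<close>, hence a nonzero integer;
  in the coordinate \<open>z\<close>, after multiplication by \<open>\<Prod>\<^sub>s h(z\<^sub>s)\<^sup>D\<close>, it is multiplied by \<open>\<phi>'(0)\<^sup>\<beta>\<close> and bounded by
  Cauchy's estimate. Comparing the two gives \<open>\<alpha> log |\<phi>'(0)| \<le> d D max(\<dots>) + o(dD)\<close>.

  The series \<open>x(t)\<close> need not converge, so the entries of the linear system in the coordinate \<open>t\<close> admit
  no bound and Siegel's lemma does not apply as it stands. Instead the pigeonhole principle is
  applied one degree at a time: on differences of coefficient vectors that agree in lower degrees,
  the next coefficients are integers and, by the same comparison, bounded.

  Algebraicity follows by applying the bound to the powers of a single \<open>f\<^sub>i\<close>.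
\<close>

section \<open>Coefficients of sums of pure tensors of power series\<close>

text \<open>As \<open>\<psi>\<close> has no constant term, \<open>\<psi> ^ l\<close> contributes
  nothing below degree l. Hence substituting \<open>\<psi>\<close> and multiplying by
  \<open>w\<close> acts on the coefficients of \<open>u\<close> by a lower triangular matrix that
  does not depend on \<open>u\<close>.\<close>

lemma fps_weighted_compose_nth:
  fixes u w \<psi> :: "'a::comm_ring_1 fps"
  assumes "fps_nth \<psi> 0 = 0"
  shows "fps_nth (w * (u oo \<psi>)) n = (\<Sum>l\<le>n. fps_nth (w * \<psi> ^ l) n * fps_nth u l)"
proof -
  have ext: "fps_nth (u oo \<psi>) k = (\<Sum>l\<le>n. fps_nth u l * fps_nth (\<psi> ^ l) k)" if "k \<le> n" for k
  proof -
    have "(\<Sum>l\<le>n. fps_nth u l * fps_nth (\<psi> ^ l) k) = (\<Sum>l=0..k. fps_nth u l * fps_nth (\<psi> ^ l) k)"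
      by (rule sum.mono_neutral_right)
        (use that assms in \<open>auto simp: startsby_zero_power_prefix\<close>)
    then show ?thesis by (simp add: fps_compose_nth)
  qed
  have "fps_nth (w * (u oo \<psi>)) n
      = (\<Sum>i=0..n. \<Sum>l\<le>n. fps_nth w i * (fps_nth u l * fps_nth (\<psi> ^ l) (n - i)))"
    by (simp add: fps_mult_nth ext sum_distrib_left)
  also have "\<dots> = (\<Sum>l\<le>n. \<Sum>i=0..n. fps_nth w i * (fps_nth u l * fps_nth (\<psi> ^ l) (n - i)))"
    by (rule sum.swap)
  also have "\<dots> = (\<Sum>l\<le>n. fps_nth (w * \<psi> ^ l) n * fps_nth u l)"
    by (simp add: fps_mult_nth sum_distrib_left mult_ac)
  finally show ?thesis .
qed

text \<open>The diagonal entries of this triangular matrix.\<close>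

lemma fps_mult_power_nth_same:
  fixes w \<psi> :: "'a::comm_ring_1 fps"
  assumes "fps_nth \<psi> 0 = 0"
  shows "fps_nth (w * \<psi> ^ n) n = fps_nth w 0 * fps_nth \<psi> 1 ^ n"
proof -
  have "fps_nth (w * \<psi> ^ n) n = (\<Sum>i\<in>{0}. fps_nth w i * fps_nth (\<psi> ^ n) (n - i))"
    unfolding fps_mult_nth
    by (rule sum.mono_neutral_right) (use assms in \<open>auto simp: startsby_zero_power_prefix\<close>)
  then show ?thesis
    using assms by (simp add: startsby_zero_power_nth_same)
qed

text \<open>The coefficient at the monomial with exponents \<open>n\<close> of the multivariate
  series with summands \<open>a j\<close> times the product over s of \<open>u (j s)\<close> in the
  s-th variable. The series itself is never formed; only its coefficients are used.\<close>

definition tensor_coeff ::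
    "'i set \<Rightarrow> 'j set \<Rightarrow> ('j \<Rightarrow> 'a::comm_ring_1 fps) \<Rightarrow> (('i \<Rightarrow> 'j) \<Rightarrow> 'a) \<Rightarrow> ('i \<Rightarrow> nat) \<Rightarrow> 'a" where
  "tensor_coeff I J u a n = (\<Sum>j\<in>PiE I (\<lambda>_. J). a j * (\<Prod>s\<in>I. fps_nth (u (j s)) (n s)))"

lemma tensor_coeff_diff:
  "tensor_coeff I J u (\<lambda>j. a j - b j) n = tensor_coeff I J u a n - tensor_coeff I J u b n"
  by (simp add: tensor_coeff_def algebra_simps sum_subtractf)

text \<open>In several variables the substitution is a tensor product of triangular matrices, so
  only exponents \<open>l\<close> that are componentwise at most \<open>n\<close> contribute. In
  lowest total degree all of them but \<open>n\<close> itself vanish, and the product of the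
  diagonal entries remains.\<close>

lemma tensor_coeff_subst_lowest:
  fixes u :: "'j \<Rightarrow> 'a::comm_ring_1 fps"
  assumes I: "finite I" and n: "n \<in> PiE I (\<lambda>_. UNIV)"
    and van: "\<And>l. l \<in> PiE I (\<lambda>_. UNIV) \<Longrightarrow> sum l I < sum n I \<Longrightarrow> tensor_coeff I J u a l = 0"
    and \<psi>: "fps_nth \<psi> 0 = 0" and w: "fps_nth w 0 = 1"
  shows "tensor_coeff I J (\<lambda>j. w * (u j oo \<psi>)) a n = fps_nth \<psi> 1 ^ sum n I * tensor_coeff I J u a n"
proof -
  define T where "T k l = fps_nth (w * \<psi> ^ l) k" for k l
  have "tensor_coeff I J (\<lambda>j. w * (u j oo \<psi>)) a n
      = (\<Sum>j\<in>PiE I (\<lambda>_. J). a j * (\<Prod>s\<in>I. \<Sum>l\<le>n s. T (n s) l * fps_nth (u (j s)) l))"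
    by (simp add: tensor_coeff_def fps_weighted_compose_nth[OF \<psi>] T_def)
  also have "\<dots> = (\<Sum>j\<in>PiE I (\<lambda>_. J). a j *
      (\<Sum>l\<in>PiE I (\<lambda>s. {..n s}). \<Prod>s\<in>I. T (n s) (l s) * fps_nth (u (j s)) (l s)))"
    using I by (simp add: prod_sum_PiE)
  also have "\<dots> = (\<Sum>j\<in>PiE I (\<lambda>_. J). \<Sum>l\<in>PiE I (\<lambda>s. {..n s}).
      (\<Prod>s\<in>I. T (n s) (l s)) * (a j * (\<Prod>s\<in>I. fps_nth (u (j s)) (l s))))"
    by (simp add: sum_distrib_left prod.distrib mult_ac)
  also have "\<dots> = (\<Sum>l\<in>PiE I (\<lambda>s. {..n s}). (\<Prod>s\<in>I. T (n s) (l s)) * tensor_coeff I J u a l)"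
    by (subst sum.swap) (simp add: tensor_coeff_def sum_distrib_left)
  also have "\<dots> = (\<Sum>l\<in>{n}. (\<Prod>s\<in>I. T (n s) (l s)) * tensor_coeff I J u a l)"
  proof (rule sum.mono_neutral_right)
    show "finite (PiE I (\<lambda>s. {..n s}))" using I by (simp add: finite_PiE)
    show "{n} \<subseteq> PiE I (\<lambda>s. {..n s})" using n by (auto simp: PiE_def)
    show "\<forall>l\<in>PiE I (\<lambda>s. {..n s}) - {n}. (\<Prod>s\<in>I. T (n s) (l s)) * tensor_coeff I J u a l = 0"
    proof
      \<comment> \<open>A componentwise smaller exponent other than \<open>n\<close> has strictly
        smaller total degree, so \<open>van\<close> applies to it.\<close>
      fix l assume l: "l \<in> PiE I (\<lambda>s. {..n s}) - {n}"
      have "l = n" if "\<forall>s\<in>I. l s = n s"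
        using that l n by (intro extensionalityI[of l I n]) (auto simp: PiE_def)
      then obtain s where s: "s \<in> I" "l s \<noteq> n s"
        using l by blast
      have le: "l s \<le> n s" if "s \<in> I" for s using l that by (auto simp: PiE_def Pi_def)
      have "sum l I < sum n I"
        by (rule sum_strict_mono_ex1) (use I le s in \<open>auto intro!: bexI[of _ s] simp: order.strict_iff_order\<close>)
      moreover have "l \<in> PiE I (\<lambda>_. UNIV)" using l by (auto simp: PiE_def)
      ultimately show "(\<Prod>s\<in>I. T (n s) (l s)) * tensor_coeff I J u a l = 0"
        using van by simp
    qed
  qed
  also have "\<dots> = fps_nth \<psi> 1 ^ sum n I * tensor_coeff I J u a n"
    using \<psi> w by (simp add: T_def fps_mult_power_nth_same power_sum)
  finally show ?thesis .
qed

text \<open>Pure tensors of independent series are independent. The induction splits off one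
  variable at a time.\<close>

lemma tensor_coeff_eq_0_imp:
  fixes u :: "'j \<Rightarrow> 'a::comm_ring_1 fps"
  assumes "finite I"
    and indep: "\<And>c. (\<And>n. (\<Sum>j\<in>J. c j * fps_nth (u j) n) = 0) \<Longrightarrow> (\<forall>j\<in>J. c j = 0)"
    and "\<And>n. n \<in> PiE I (\<lambda>_. UNIV) \<Longrightarrow> tensor_coeff I J u a n = 0"
    and "j \<in> PiE I (\<lambda>_. J)"
  shows "a j = 0"
  using assms(1,3,4)
proof (induction I arbitrary: a j rule: finite_induct)
  case empty
  then show ?case by (simp add: tensor_coeff_def)
next
  case (insert i I)
  have expand: "tensor_coeff (insert i I) J u a (n(i:=k))
     = (\<Sum>y\<in>J. tensor_coeff I J u (\<lambda>g. a (g(i:=y))) n * fps_nth (u y) k)" for n k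
  proof -
    have inj: "inj_on (\<lambda>(y, g). g(i := y)) (J \<times> PiE I (\<lambda>_. J))"
      using inj_combinator[OF insert.hyps(2), of "\<lambda>_. J"] by simp
    have pr: "(\<Prod>s\<in>I. fps_nth (u (if s = i then y else g s)) (if s = i then k else n s))
       = (\<Prod>s\<in>I. fps_nth (u (g s)) (n s))" for y g
      by (rule prod.cong) (use insert.hyps in auto)
    have "tensor_coeff (insert i I) J u a (n(i:=k))
       = (\<Sum>(y,g)\<in>J \<times> PiE I (\<lambda>_. J). a (g(i:=y)) * (fps_nth (u y) k * (\<Prod>s\<in>I. fps_nth (u (g s)) (n s))))"
      unfolding tensor_coeff_def PiE_insert_eq
      by (subst sum.reindex[OF inj], rule sum.cong)
         (use insert.hyps in \<open>auto simp: fun_upd_def pr\<close>)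
    also have "\<dots> = (\<Sum>y\<in>J. \<Sum>g\<in>PiE I (\<lambda>_. J). a (g(i:=y)) * (fps_nth (u y) k * (\<Prod>s\<in>I. fps_nth (u (g s)) (n s))))"
      by (simp add: sum.cartesian_product)
    finally show ?thesis
      by (simp add: tensor_coeff_def sum_distrib_left mult_ac)
  qed
  have z: "tensor_coeff I J u (\<lambda>g. a (g(i:=y))) n = 0"
    if n: "n \<in> PiE I (\<lambda>_. UNIV)" and y: "y \<in> J" for n y
  proof -
    \<comment> \<open>With the exponents of the other variables frozen at \<open>n\<close>, letting
      the exponent \<open>k\<close> of the variable \<open>i\<close> vary gives a linear relation
      between the series \<open>u y\<close>.\<close>
    have "\<forall>y\<in>J. tensor_coeff I J u (\<lambda>g. a (g(i:=y))) n = 0"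
    proof (rule indep)
      fix k
      have "n(i:=k) \<in> PiE (insert i I) (\<lambda>_. UNIV)"
        using n by (auto simp: PiE_def extensional_def)
      then show "(\<Sum>y\<in>J. tensor_coeff I J u (\<lambda>g. a (g(i:=y))) n * fps_nth (u y) k) = 0"
        using insert.prems(1) expand by metis
    qed
    then show ?thesis using y by blast
  qed
  obtain y g where yg: "y \<in> J" "g \<in> PiE I (\<lambda>_. J)" "j = g(i:=y)"
    using insert.prems(2) by (auto simp: PiE_insert_eq)
  then show ?case using insert.IH[OF z[OF _ yg(1)] yg(2)] by simp
qed

section \<open>Counting and the pigeonhole principle\<close>

text \<open>Membership in \<open>PiE\<close> fixes the values outside \<open>I\<close>, so each
  monomial is counted exactly once.\<close>

definition degree_indices :: "'i set \<Rightarrow> nat \<Rightarrow> ('i \<Rightarrow> nat) set" where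
  "degree_indices I \<beta> = {n \<in> PiE I (\<lambda>_. UNIV). sum n I = \<beta>}"

lemma degree_indices_subset:
  fixes I :: "'i set"
  assumes "finite I" shows "degree_indices I \<beta> \<subseteq> PiE I (\<lambda>_. {..\<beta>})"
proof
  fix n assume "n \<in> degree_indices I \<beta>"
  then have n: "n \<in> PiE I (\<lambda>_. UNIV)" "sum n I = \<beta>"
    by (simp_all add: degree_indices_def)
  have "n s \<le> sum n I" if "s \<in> I" for s
    using assms that by (intro member_le_sum) simp_all
  with n show "n \<in> PiE I (\<lambda>_. {..\<beta>})"
    by (simp add: PiE_def Pi_def)
qed

lemma finite_degree_indices: "finite I \<Longrightarrow> finite (degree_indices I \<beta>)"
  by (rule finite_subset[OF degree_indices_subset]) (auto intro: finite_PiE)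

lemma sum_power_le_inverse:
  fixes q :: real
  assumes "0 \<le> q" "q < 1"
  shows "(\<Sum>k<n. q ^ k) \<le> 1 / (1 - q)"
proof -
  have "(\<Sum>k<n. q ^ k) \<le> (\<Sum>k. q ^ k)"
    using assms by (intro sum_le_suminf summable_geometric) auto
  then show ?thesis using assms by (simp add: suminf_geometric)
qed

text \<open>Rankin's trick: weighting the index \<open>n\<close> by \<open>exp (\<epsilon> (\<alpha> - |n|))\<close> with \<open>\<epsilon> = d / \<alpha>\<close> already
  gives the sharp exponential rate, so no asymptotics of binomial coefficients are needed.\<close>

lemma sum_card_degree_indices_le:
  assumes I: "finite I" "I \<noteq> {}" and \<alpha>: "\<alpha> > 0"
  shows "real (\<Sum>\<beta><\<alpha>. card (degree_indices I \<beta>)) \<le> (exp 1 * (1 + real \<alpha> / real (card I))) ^ card I"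
proof -
  define d where "d = real (card I)"
  have d: "d > 0" using I by (simp add: d_def card_gt_0_iff)
  define \<epsilon> where "\<epsilon> = d / real \<alpha>"
  have \<epsilon>: "\<epsilon> > 0" using d \<alpha> by (simp add: \<epsilon>_def)
  define q where "q = exp (- \<epsilon>)"
  have q: "0 \<le> q" "q < 1" using \<epsilon> by (auto simp: q_def)
  define X where "X = (\<Union>\<beta><\<alpha>. degree_indices I \<beta>)"
  have X_sub: "X \<subseteq> PiE I (\<lambda>_. {..<\<alpha>})"
  proof
    fix n assume "n \<in> X"
    then obtain \<beta> where "\<beta> < \<alpha>" "n \<in> degree_indices I \<beta>" by (auto simp: X_def)
    then have "n \<in> PiE I (\<lambda>_. {..\<beta>})" "{..\<beta>} \<subseteq> {..<\<alpha>}"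
      using degree_indices_subset[OF I(1)] by auto
    then show "n \<in> PiE I (\<lambda>_. {..<\<alpha>})" using PiE_mono by blast
  qed
  have finP: "finite (PiE I (\<lambda>_. {..<\<alpha>}))" using I by (intro finite_PiE) auto
  have "(\<Sum>\<beta><\<alpha>. card (degree_indices I \<beta>)) = card X"
    unfolding X_def using I
    by (subst card_UN_disjoint) (auto simp: finite_degree_indices, auto simp: degree_indices_def)
  also have "real (card X) = (\<Sum>n\<in>X. 1)" by simp
  also have "\<dots> \<le> (\<Sum>n\<in>X. exp d * (\<Prod>s\<in>I. q ^ n s))"
  proof (rule sum_mono)
    fix n assume "n \<in> X"
    then have "sum n I < \<alpha>" by (auto simp: X_def degree_indices_def)
    then have "\<epsilon> * real (sum n I) \<le> \<epsilon> * real \<alpha>"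
      using \<epsilon> by (intro mult_left_mono) (simp_all del: of_nat_sum)
    then have "\<epsilon> * real (sum n I) \<le> d" using \<alpha> by (simp add: \<epsilon>_def del: of_nat_sum)
    then have "0 \<le> d - \<epsilon> * real (sum n I)" by simp
    then have "1 \<le> exp (d - \<epsilon> * real (sum n I))" by (rule one_le_exp_iff[THEN iffD2])
    also have "\<dots> = exp d * q ^ sum n I"
      by (simp add: q_def exp_diff exp_minus power_inverse divide_inverse exp_of_nat_mult[symmetric] mult.commute del: of_nat_sum)
    finally show "1 \<le> exp d * (\<Prod>s\<in>I. q ^ n s)" by (simp add: power_sum)
  qed
  also have "\<dots> \<le> (\<Sum>n\<in>PiE I (\<lambda>_. {..<\<alpha>}). exp d * (\<Prod>s\<in>I. q ^ n s))"
    using X_sub finP q by (intro sum_mono2) (auto intro!: mult_nonneg_nonneg prod_nonneg)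
  also have "\<dots> = exp d * (\<Sum>k<\<alpha>. q ^ k) ^ card I"
  proof -
    have "(\<Prod>s\<in>I. \<Sum>k<\<alpha>. q ^ k) = (\<Sum>n\<in>PiE I (\<lambda>_. {..<\<alpha>}). \<Prod>s\<in>I. q ^ n s)"
      using I(1) by (rule prod_sum_PiE) auto
    then show ?thesis by (simp add: sum_distrib_left[symmetric])
  qed
  also have "\<dots> \<le> exp d * (1 + 1 / \<epsilon>) ^ card I"
  proof -
    \<comment> \<open>This elementary inequality bounds the geometric series by 1 + 1 / \<epsilon>,
      which is 1 + \<alpha> / d.\<close>
    have "1 + \<epsilon> \<le> exp \<epsilon>" by (rule exp_ge_add_one_self)
    then have "q \<le> 1 / (1 + \<epsilon>)" using \<epsilon> by (simp add: q_def exp_minus field_simps)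
    then have "\<epsilon> / (1 + \<epsilon>) \<le> 1 - q" using \<epsilon> by (simp add: field_simps)
    then have "1 / (1 - q) \<le> 1 / (\<epsilon> / (1 + \<epsilon>))" using \<epsilon> q by (intro divide_left_mono) auto
    also have "\<dots> = 1 + 1 / \<epsilon>" using \<epsilon> by (simp add: field_simps)
    finally have "(\<Sum>k<\<alpha>. q ^ k) \<le> 1 + 1 / \<epsilon>"
      using sum_power_le_inverse[OF q, of \<alpha>] by linarith
    then show ?thesis
      using q by (intro mult_left_mono power_mono) (auto intro: sum_nonneg)
  qed
  also have "\<dots> = (exp 1 * (1 + real \<alpha> / real (card I))) ^ card I"
    by (simp add: \<epsilon>_def d_def power_mult_distrib exp_of_nat_mult[symmetric])
  finally show ?thesis .
qed

text \<open>Among vectors agreeing in all degrees below \<beta>, each value in degree \<beta> is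
  confined to 2 * floor Y + 1 possibilities once one vector is taken as origin. Keeping the largest
  class therefore costs at most that factor per index, and the costs multiply over the
  degrees.\<close>

lemma iterated_pigeonhole:
  fixes c :: "'a \<Rightarrow> 'n \<Rightarrow> rat" and X :: "nat \<Rightarrow> 'n set" and Y :: real
  assumes S: "finite S" and X: "\<And>\<beta>. finite (X \<beta>)"
    and step: "\<And>a b \<beta> n. a \<in> S \<Longrightarrow> b \<in> S \<Longrightarrow> n \<in> X \<beta> \<Longrightarrow>
        (\<And>\<gamma> l. \<gamma> < \<beta> \<Longrightarrow> l \<in> X \<gamma> \<Longrightarrow> c a l = c b l) \<Longrightarrow>
        c a n - c b n \<in> \<int> \<and> \<bar>of_rat (c a n - c b n)\<bar> \<le> Y"
  shows "\<exists>S'\<subseteq>S. (\<forall>a\<in>S'. \<forall>b\<in>S'. \<forall>\<gamma><\<beta>. \<forall>l\<in>X \<gamma>. c a l = c b l) \<and>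
           card S \<le> card S' * nat (2 * \<lfloor>Y\<rfloor> + 1) ^ (\<Sum>\<gamma><\<beta>. card (X \<gamma>))"
proof (induction \<beta>)
  case 0
  show ?case by (intro exI[of _ S]) auto
next
  case (Suc \<beta>)
  define V where "V = nat (2 * \<lfloor>Y\<rfloor> + 1)"
  from Suc obtain S' where S': "S' \<subseteq> S"
    and eq: "\<And>a b \<gamma> l. a \<in> S' \<Longrightarrow> b \<in> S' \<Longrightarrow> \<gamma> < \<beta> \<Longrightarrow> l \<in> X \<gamma> \<Longrightarrow> c a l = c b l"
    and card: "card S \<le> card S' * V ^ (\<Sum>\<gamma><\<beta>. card (X \<gamma>))"
    unfolding V_def by blast
  have finS': "finite S'" using S' S by (rule finite_subset)
  show ?case
  proof (cases "S' = {}")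
    case True
    then show ?thesis using card by (intro exI[of _ "{}"]) auto
  next
    case False
    then obtain a0 where a0: "a0 \<in> S'" by blast
    define T where "T = PiE (X \<beta>) (\<lambda>_. {- \<lfloor>Y\<rfloor>..\<lfloor>Y\<rfloor>})"
    \<comment> \<open>The values \<open>c b n\<close> themselves need be neither integral nor
      bounded; only differences are, hence the base point \<open>a0\<close>.\<close>
    define g where "g b = restrict (\<lambda>n. \<lfloor>c b n - c a0 n\<rfloor>) (X \<beta>)" for b
    have int: "c b n - c a0 n \<in> \<int>" "\<bar>of_rat (c b n - c a0 n)\<bar> \<le> Y"
      if "b \<in> S'" "n \<in> X \<beta>" for b n
    proof -
      have "c b n - c a0 n \<in> \<int> \<and> \<bar>of_rat (c b n - c a0 n)\<bar> \<le> Y"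
        by (rule step) (use that S' a0 in \<open>auto intro: eq\<close>)
      then show "c b n - c a0 n \<in> \<int>" "\<bar>of_rat (c b n - c a0 n)\<bar> \<le> Y" by simp_all
    qed
    have gT: "g \<in> S' \<rightarrow> T"
    proof
      fix b assume b: "b \<in> S'"
      have "\<lfloor>c b n - c a0 n\<rfloor> \<in> {- \<lfloor>Y\<rfloor>..\<lfloor>Y\<rfloor>}" if n: "n \<in> X \<beta>" for n
      proof -
        obtain k where k: "c b n - c a0 n = of_int k" using int(1)[OF b n] by (auto elim: Ints_cases)
        then have "\<bar>real_of_int k\<bar> \<le> Y" using int(2)[OF b n] by simp
        then have "k \<le> \<lfloor>Y\<rfloor>" "- k \<le> \<lfloor>Y\<rfloor>" by (auto simp: le_floor_iff)
        then show ?thesis using k by simp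
      qed
      then show "g b \<in> T" by (auto simp: g_def T_def)
    qed
    have cardT: "card T = V ^ card (X \<beta>)"
      unfolding T_def V_def using X by (simp add: card_PiE)
    have "T \<noteq> {}" using gT a0 by blast
    moreover have "finite T" unfolding T_def using X by (intro finite_PiE) auto
    ultimately obtain y where y: "card S' \<le> card (g -` {y} \<inter> S') * card T"
      using pigeonhole_card[OF gT finS'] by blast
    define S'' where "S'' = g -` {y} \<inter> S'"
    have "S'' \<subseteq> S" using S' by (auto simp: S''_def)
    moreover have "c a l = c b l" if ab: "a \<in> S''" "b \<in> S''" and \<gamma>: "\<gamma> < Suc \<beta>" "l \<in> X \<gamma>" for a b \<gamma> l
    proof (cases "\<gamma> = \<beta>")
      case True
      have "g a l = g b l" using ab by (simp add: S''_def)
      then have "\<lfloor>c a l - c a0 l\<rfloor> = \<lfloor>c b l - c a0 l\<rfloor>" using \<gamma> True by (simp add: g_def)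
      moreover have "c a l - c a0 l \<in> \<int>" "c b l - c a0 l \<in> \<int>"
        using int(1)[of a l] int(1)[of b l] ab \<gamma> True by (auto simp: S''_def)
      ultimately show ?thesis by (auto elim!: Ints_cases)
    next
      case False
      then show ?thesis using eq[of a b \<gamma> l] ab \<gamma> by (auto simp: S''_def)
    qed
    moreover have "card S \<le> card S'' * V ^ (\<Sum>\<gamma><Suc \<beta>. card (X \<gamma>))"
    proof -
      have "card S \<le> card S' * V ^ (\<Sum>\<gamma><\<beta>. card (X \<gamma>))" by (rule card)
      also have "\<dots> \<le> (card S'' * V ^ card (X \<beta>)) * V ^ (\<Sum>\<gamma><\<beta>. card (X \<gamma>))"
        using y unfolding S''_def cardT by (rule mult_right_mono) simp
      finally show ?thesis by (simp add: power_add mult_ac)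
    qed
    ultimately show ?thesis unfolding V_def by blast
  qed
qed

section \<open>The auxiliary function\<close>

lemma norm_of_rat_complex: "cmod (of_rat q) = \<bar>of_rat q\<bar>"
proof -
  have "of_rat q = complex_of_real (of_rat q)"
    by (cases q) (simp add: of_rat_rat)
  then show ?thesis by (metis norm_of_real)
qed

text \<open>In the lowest total degree a coefficient can be read off in any coordinate tangent to \<open>x\<close>:
  it is an integer because it is so in the coordinate \<open>t\<close>, and its size is controlled in the
  coordinate \<open>z\<close>.\<close>

lemma tensor_coeff_lowest_integral_bounded:
  fixes u :: "'j \<Rightarrow> rat fps" and a :: "('i \<Rightarrow> 'j) \<Rightarrow> int" and \<psi> w :: "complex fps"
  assumes I: "finite I"
    and x: "fps_nth x 0 = 0" "fps_nth x 1 = 1"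
    and int: "\<And>j. j \<in> J \<Longrightarrow> fps_int_coeffs (u j oo x)"
    and \<psi>: "fps_nth \<psi> 0 = 0" and w: "fps_nth w 0 = 1"
    and R: "\<And>j n. j \<in> J \<Longrightarrow> cmod (fps_nth (w * (fps_complex_of_rat (u j) oo \<psi>)) n) \<le> R"
    and B: "\<And>j. j \<in> PiE I (\<lambda>_. J) \<Longrightarrow> \<bar>real_of_int (a j)\<bar> \<le> B"
    and n: "n \<in> PiE I (\<lambda>_. UNIV)"
    and van: "\<And>l. l \<in> PiE I (\<lambda>_. UNIV) \<Longrightarrow> sum l I < sum n I \<Longrightarrow>
                tensor_coeff I J u (\<lambda>j. of_int (a j)) l = 0"
  defines "c \<equiv> tensor_coeff I J u (\<lambda>j. of_int (a j)) n"
  shows "c \<in> \<int>"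
    and "cmod (fps_nth \<psi> 1) ^ sum n I * \<bar>of_rat c\<bar> \<le> real (card J ^ card I) * B * R ^ card I"
proof -
  \<comment> \<open>Substitution of \<open>x\<close> with weight 1: its linear coefficient is 1, so
    the lowest coefficient does not change.\<close>
  have "c = tensor_coeff I J (\<lambda>j. 1 * (u j oo x)) (\<lambda>j. of_int (a j)) n"
    using tensor_coeff_subst_lowest[OF I n van x(1), of 1] x by (simp add: c_def)
  also have "\<dots> \<in> \<int>"
    unfolding tensor_coeff_def
  proof (intro Ints_sum Ints_mult Ints_prod Ints_of_int)
    fix j s assume "j \<in> PiE I (\<lambda>_. J)" "s \<in> I"
    then have "j s \<in> J" by (rule PiE_mem)
    then show "fps_nth (1 * (u (j s) oo x)) (n s) \<in> \<int>"
      using int by (simp add: fps_int_coeffs_def)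
  qed
  finally show "c \<in> \<int>" .
  define cu where "cu j = fps_complex_of_rat (u j)" for j
  have of_rat: "tensor_coeff I J cu (\<lambda>j. of_int (a j)) l
      = of_rat (tensor_coeff I J u (\<lambda>j. of_int (a j)) l)" for l
    by (simp add: tensor_coeff_def cu_def fps_complex_of_rat_def of_rat_sum of_rat_mult of_rat_prod)
  have "tensor_coeff I J (\<lambda>j. w * (cu j oo \<psi>)) (\<lambda>j. of_int (a j)) n
      = fps_nth \<psi> 1 ^ sum n I * tensor_coeff I J cu (\<lambda>j. of_int (a j)) n"
    by (rule tensor_coeff_subst_lowest[OF I n _ \<psi> w]) (simp add: of_rat van)
  then have "cmod (fps_nth \<psi> 1) ^ sum n I * \<bar>of_rat c\<bar>
      = cmod (tensor_coeff I J (\<lambda>j. w * (cu j oo \<psi>)) (\<lambda>j. of_int (a j)) n)"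
    by (simp add: norm_mult norm_power of_rat c_def norm_of_rat_complex)
  also have "\<dots> \<le> (\<Sum>j\<in>PiE I (\<lambda>_. J). B * R ^ card I)"
    unfolding tensor_coeff_def
  proof (rule sum_norm_le)
    fix j assume j: "j \<in> PiE I (\<lambda>_. J)"
    have "(\<Prod>s\<in>I. cmod (fps_nth (w * (cu (j s) oo \<psi>)) (n s))) \<le> (\<Prod>s\<in>I. R)"
    proof (rule prod_mono)
      fix s assume "s \<in> I"
      then have "j s \<in> J" using j by (rule PiE_mem[rotated])
      then show "0 \<le> cmod (fps_nth (w * (cu (j s) oo \<psi>)) (n s)) \<and>
                 cmod (fps_nth (w * (cu (j s) oo \<psi>)) (n s)) \<le> R"
        using R by (simp add: cu_def)
    qed
    then have "\<bar>real_of_int (a j)\<bar> * (\<Prod>s\<in>I. cmod (fps_nth (w * (cu (j s) oo \<psi>)) (n s))) \<le> B * R ^ card I"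
      using B[OF j] by (intro mult_mono) (auto intro: prod_nonneg)
    then show "cmod (of_int (a j) * (\<Prod>s\<in>I. fps_nth (w * (cu (j s) oo \<psi>)) (n s))) \<le> B * R ^ card I"
      by (simp add: norm_mult prod_norm)
  qed
  also have "\<dots> = real (card J ^ card I) * B * R ^ card I"
    using I by (simp add: card_PiE)
  finally show "cmod (fps_nth \<psi> 1) ^ sum n I * \<bar>of_rat c\<bar> \<le> real (card J ^ card I) * B * R ^ card I" .
qed

text \<open>The assumption \<open>big\<close> says that there are more coefficient vectors with
  entries in [0, B) than the pigeonhole principle can separate below degree \<alpha>. Two of them
  differ by a nonzero vector whose series vanishes below degree \<alpha>, and its lowest nonzero
  coefficient is an integer, so at least 1 in absolute value.\<close>

lemma derivative_power_le:
  fixes u :: "'j \<Rightarrow> rat fps" and \<psi> w :: "complex fps" and I :: "'i set"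
  assumes I: "finite I" and J: "finite J"
    and indep: "\<And>c. (\<And>n. (\<Sum>j\<in>J. c j * fps_nth (u j) n) = 0) \<Longrightarrow> (\<forall>j\<in>J. c j = 0)"
    and x: "fps_nth x 0 = 0" "fps_nth x 1 = 1"
    and int: "\<And>j. j \<in> J \<Longrightarrow> fps_int_coeffs (u j oo x)"
    and \<psi>: "fps_nth \<psi> 0 = 0" "cmod (fps_nth \<psi> 1) \<ge> 1" and w: "fps_nth w 0 = 1"
    and R: "\<And>j n. j \<in> J \<Longrightarrow> cmod (fps_nth (w * (fps_complex_of_rat (u j) oo \<psi>)) n) \<le> R"
  defines "N \<equiv> card J ^ card I"
  assumes big: "nat (2 * \<lfloor>real N * real B * R ^ card I\<rfloor> + 1)
                  ^ (\<Sum>\<beta><\<alpha>. card (degree_indices I \<beta>)) < B ^ N"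
  shows "cmod (fps_nth \<psi> 1) ^ \<alpha> \<le> real N * real B * R ^ card I"
proof -
  define Y where "Y = real N * real B * R ^ card I"
  define P where "P = PiE I (\<lambda>_. J)"
  have finP: "finite P" unfolding P_def using I J by (intro finite_PiE) auto
  have cardP: "card P = N" unfolding P_def N_def using I by (simp add: card_PiE)
  define S where "S = PiE P (\<lambda>_. {0..<int B})"
  have finS: "finite S" unfolding S_def using finP by (intro finite_PiE) auto
  have cardS: "card S = B ^ N" unfolding S_def using finP by (simp add: card_PiE cardP)
  define c where "c a = tensor_coeff I J u (\<lambda>j. of_int (a j))" for a :: "('i \<Rightarrow> 'j) \<Rightarrow> int"
  have c_diff: "c (\<lambda>j. a j - b j) l = c a l - c b l" for a b l
    by (simp add: c_def tensor_coeff_diff)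
  have diff_le: "\<bar>real_of_int (a j - b j)\<bar> \<le> real B" if ab: "a \<in> S" "b \<in> S" and j: "j \<in> P" for a b j
  proof -
    have "a j \<in> {0..<int B}" "b j \<in> {0..<int B}"
      using ab j unfolding S_def by (auto dest: PiE_mem)
    then have "\<bar>a j - b j\<bar> \<le> int B" by auto
    then show ?thesis by linarith
  qed
  note lowest = tensor_coeff_lowest_integral_bounded[OF I x int \<psi>(1) w R]
  have key: "c (\<lambda>j. a j - b j) n \<in> \<int>"
      "cmod (fps_nth \<psi> 1) ^ sum n I * \<bar>of_rat (c (\<lambda>j. a j - b j) n)\<bar> \<le> Y"
    if ab: "a \<in> S" "b \<in> S" and n: "n \<in> PiE I (\<lambda>_. UNIV)"
      and van: "\<And>l. l \<in> PiE I (\<lambda>_. UNIV) \<Longrightarrow> sum l I < sum n I \<Longrightarrow> c (\<lambda>j. a j - b j) l = 0" for a b n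
    unfolding c_def Y_def N_def
    by (rule lowest[where B = "real B"];
        use diff_le[OF ab] n van in \<open>simp add: P_def c_def\<close>)+
  have "\<exists>S'\<subseteq>S. (\<forall>a\<in>S'. \<forall>b\<in>S'. \<forall>\<gamma><\<alpha>. \<forall>l\<in>degree_indices I \<gamma>. c a l = c b l) \<and>
      card S \<le> card S' * nat (2 * \<lfloor>Y\<rfloor> + 1) ^ (\<Sum>\<gamma><\<alpha>. card (degree_indices I \<gamma>))"
  proof (rule iterated_pigeonhole[OF finS finite_degree_indices[OF I]])
    fix a b \<beta> n
    assume ab: "a \<in> S" "b \<in> S" and n: "n \<in> degree_indices I \<beta>"
      and eq: "\<And>\<gamma> l. \<gamma> < \<beta> \<Longrightarrow> l \<in> degree_indices I \<gamma> \<Longrightarrow> c a l = c b l"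
    have n': "n \<in> PiE I (\<lambda>_. UNIV)" "sum n I = \<beta>" using n by (simp_all add: degree_indices_def)
    have van: "c (\<lambda>j. a j - b j) l = 0" if "l \<in> PiE I (\<lambda>_. UNIV)" "sum l I < sum n I" for l
      using eq[of "sum l I" l] that n' by (simp add: c_diff degree_indices_def)
    \<comment> \<open>Dropping a factor that is at least 1 gives the same bound \<open>Y\<close> in
      every degree, as the pigeonhole argument requires.\<close>
    have "1 * \<bar>real_of_rat (c (\<lambda>j. a j - b j) n)\<bar>
        \<le> cmod (fps_nth \<psi> 1) ^ sum n I * \<bar>of_rat (c (\<lambda>j. a j - b j) n)\<bar>"
      using \<psi>(2) by (intro mult_right_mono one_le_power) auto
    then show "c a n - c b n \<in> \<int> \<and> \<bar>of_rat (c a n - c b n)\<bar> \<le> Y"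
      using key[OF ab n'(1) van] by (simp add: c_diff)
  qed
  then obtain S' where S': "S' \<subseteq> S"
    and eq: "\<And>a b \<gamma> l. a \<in> S' \<Longrightarrow> b \<in> S' \<Longrightarrow> \<gamma> < \<alpha> \<Longrightarrow> l \<in> degree_indices I \<gamma> \<Longrightarrow> c a l = c b l"
    and card: "card S \<le> card S' * nat (2 * \<lfloor>Y\<rfloor> + 1) ^ (\<Sum>\<gamma><\<alpha>. card (degree_indices I \<gamma>))"
    by blast
  have "\<not> card S' \<le> 1"
  proof
    assume "card S' \<le> 1"
    then have "card S' * nat (2 * \<lfloor>Y\<rfloor> + 1) ^ (\<Sum>\<gamma><\<alpha>. card (degree_indices I \<gamma>)) \<le>
        1 * nat (2 * \<lfloor>Y\<rfloor> + 1) ^ (\<Sum>\<gamma><\<alpha>. card (degree_indices I \<gamma>))"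
      by (rule mult_right_mono) simp
    with card big show False unfolding cardS Y_def by linarith
  qed
  then obtain a b where ab: "a \<in> S'" "b \<in> S'" "a \<noteq> b"
    by (metis One_nat_def S' card_le_Suc0_iff_eq finS finite_subset)
  then have abS: "a \<in> S" "b \<in> S" using S' by auto
  define e where "e = (\<lambda>j. a j - b j)"
  have e_ne: "\<exists>j\<in>P. e j \<noteq> 0"
  proof (rule ccontr)
    assume "\<not> ?thesis"
    then have "a j = b j" if "j \<in> P" for j using that by (auto simp: e_def)
    then have "a = b" using abS unfolding S_def by (intro PiE_ext)
    with ab show False by simp
  qed
  define Q where "Q \<beta> \<longleftrightarrow> (\<exists>n\<in>degree_indices I \<beta>. c e n \<noteq> 0)" for \<beta>
  \<comment> \<open>Independence of the pure tensors guarantees that the auxiliary series is not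
    zero, so that a lowest degree exists.\<close>
  have "\<exists>\<beta>. Q \<beta>"
  proof (rule ccontr)
    assume none: "\<nexists>\<beta>. Q \<beta>"
    have "of_int (e j) = (0::rat)" if "j \<in> P" for j
    proof (rule tensor_coeff_eq_0_imp[OF I indep])
      show "tensor_coeff I J u (\<lambda>j. of_int (e j)) n = 0" if "n \<in> PiE I (\<lambda>_. UNIV)" for n
        using none that by (auto simp: Q_def degree_indices_def c_def)
    qed (use that in \<open>auto simp: P_def\<close>)
    with e_ne show False by auto
  qed
  then obtain \<beta> where "Q \<beta>" and least: "\<And>\<gamma>. \<gamma> < \<beta> \<Longrightarrow> \<not> Q \<gamma>"
    using exists_least_iff[of Q] by auto
  then obtain n where n: "n \<in> PiE I (\<lambda>_. UNIV)" "sum n I = \<beta>" "c e n \<noteq> 0"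
    by (auto simp: Q_def degree_indices_def)
  have "\<alpha> \<le> \<beta>"
  proof (rule ccontr)
    assume "\<not> \<alpha> \<le> \<beta>"
    then have "c a n = c b n"
      using eq[OF ab(1,2), of \<beta> n] n by (simp add: degree_indices_def)
    with n(3) show False by (simp add: e_def c_diff)
  qed
  have "c e l = 0" if "l \<in> PiE I (\<lambda>_. UNIV)" "sum l I < sum n I" for l
    using least[of "sum l I"] that n by (auto simp: Q_def degree_indices_def)
  then have int_c: "c e n \<in> \<int>" and bd: "cmod (fps_nth \<psi> 1) ^ \<beta> * \<bar>of_rat (c e n)\<bar> \<le> Y"
    using key[OF abS n(1)] n(2) unfolding e_def by auto
  obtain k where k: "c e n = of_int k" using int_c by (auto elim: Ints_cases)
  with n(3) have "k \<noteq> 0" by auto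
  then have "1 \<le> \<bar>real_of_int k\<bar>" by linarith
  then have "1 \<le> \<bar>real_of_rat (c e n)\<bar>" using k by simp
  have "cmod (fps_nth \<psi> 1) ^ \<alpha> * 1 \<le> cmod (fps_nth \<psi> 1) ^ \<beta> * \<bar>of_rat (c e n)\<bar>"
    using \<psi>(2) \<open>\<alpha> \<le> \<beta>\<close> \<open>1 \<le> \<bar>real_of_rat (c e n)\<bar>\<close>
    by (intro mult_mono power_increasing) auto
  with bd show ?thesis by (simp add: Y_def)
qed

section \<open>Choice of the parameters and the limiting argument\<close>

text \<open>If the claim failed, some \<theta> would lie strictly between log H / log \<rho> and m /
  e. Vanishing to order about \<theta> d D is affordable because \<theta> < m / e, whereas \<theta>
  log \<rho> > log H contradicts the conclusion of \<open>ineq\<close>. The order of choice is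
  \<theta>, r, K, then d, then D with d fixed.\<close>

lemma parameter_optimization:
  fixes \<rho> H A :: real and m :: nat
  assumes m: "m > 0" and \<rho>: "\<rho> > 1" and H: "H \<ge> 1" and A: "A \<ge> 1"
    and ineq: "\<And>d D \<alpha> B :: nat. d > 0 \<Longrightarrow> D > 0 \<Longrightarrow>
        nat (2 * \<lfloor>real ((m * D) ^ d) * real B * (A * H ^ D) ^ d\<rfloor> + 1)
          ^ (\<Sum>\<beta><\<alpha>. card (degree_indices {..<d} \<beta>)) < B ^ ((m * D) ^ d) \<Longrightarrow>
        \<rho> ^ \<alpha> \<le> real ((m * D) ^ d) * real B * (A * H ^ D) ^ d"
  shows "real m * ln \<rho> \<le> exp 1 * ln H"
proof (rule ccontr)
  assume "\<not> ?thesis"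
  then have less: "exp 1 * ln H < real m * ln \<rho>" by simp
  define L where "L = ln \<rho>"
  define \<mu> where "\<mu> = ln H"
  have L: "L > 0" using \<rho> by (simp add: L_def)
  have \<mu>: "\<mu> \<ge> 0" using H by (simp add: \<mu>_def)
  have "\<mu> / L < real m / exp 1"
    using less L by (simp add: L_def \<mu>_def field_simps)
  then obtain \<theta> where \<theta>1: "\<mu> / L < \<theta>" and \<theta>2: "\<theta> < real m / exp 1" using dense by blast
  have "0 \<le> \<mu> / L" using \<mu> L by simp
  with \<theta>1 have \<theta>: "\<theta> > 0" by linarith
  define \<delta> where "\<delta> = \<theta> * L - \<mu>"
  have \<delta>: "\<delta> > 0" using \<theta>1 L by (simp add: \<delta>_def field_simps)
  have "exp 1 * \<theta> / real m < 1" using \<theta>2 m by (simp add: field_simps)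
  then obtain r where r1: "exp 1 * \<theta> / real m < r" and r2: "r < 1" using dense by blast
  have "0 < exp 1 * \<theta> / real m" using \<theta> m by simp
  with r1 have r0: "r > 0" by linarith
  have rm: "exp 1 * \<theta> < r * real m" using r1 m by (simp add: field_simps)
  \<comment> \<open>K + 1 is the prescribed ratio of parameters to equations; it is chosen so that
    the loss \<mu> / K, caused by the size of the coefficients, uses up at most half of the gap
    \<delta>.\<close>
  obtain K0 :: nat where "2 * \<mu> / \<delta> < real K0" using reals_Archimedean2 by blast
  define K where "K = Suc K0"
  have K: "K \<ge> 1" and "2 * \<mu> / \<delta> < real K"
    using \<open>2 * \<mu> / \<delta> < real K0\<close> by (simp_all add: K_def)
  then have K\<mu>: "\<mu> / real K \<le> \<delta> / 2" using \<delta> by (simp add: field_simps)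
  \<comment> \<open>The ratio of equations to parameters will be at most r to the power d, so enough
    variables make it smaller than 1 / (K + 1).\<close>
  obtain d0 where d0: "r ^ d0 < 1 / real (K + 1)"
    using real_arch_pow_inv[of "1 / real (K + 1)" r] r2 by auto
  define d where "d = Suc d0"
  have d: "d > 0" by (simp add: d_def)
  have "r ^ d \<le> r ^ d0" unfolding d_def using r0 r2 by (intro power_decreasing) auto
  with d0 have rd: "r ^ d \<le> 1 / real (K + 1)" by linarith
  have "\<forall>\<^sub>F D :: nat in sequentially. exp 1 * (2 + \<theta> * real D) \<le> r * real m * real D"
  proof -
    have "\<forall>\<^sub>F D :: nat in sequentially. exp 1 * 2 \<le> (r * real m - exp 1 * \<theta>) * real D"
      using rm by real_asymp
    then show ?thesis by eventually_elim (simp add: algebra_simps)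
  qed
  moreover have "\<forall>\<^sub>F D :: nat in sequentially.
      2 * ln (real m * real D) + (2 * ln A + ln 2 + ln 3) < \<delta> / 2 * real D"
    using m \<delta> by real_asymp
  moreover have "\<forall>\<^sub>F D :: nat in sequentially. D > 0" by (rule eventually_gt_at_top)
  ultimately have "\<forall>\<^sub>F D :: nat in sequentially. D > 0 \<and>
      exp 1 * (2 + \<theta> * real D) \<le> r * real m * real D \<and>
      2 * ln (real m * real D) + (2 * ln A + ln 2 + ln 3) < \<delta> / 2 * real D"
    by eventually_elim blast
  \<comment> \<open>In \<open>D1\<close> the constant 2 absorbs the summand 1 of the monomial count
    and the rounding of \<alpha>. \<open>D2\<close> makes all logarithmic terms smaller than the
    remaining half of the gap.\<close>
  then obtain D where D: "D > 0"
    and D1: "exp 1 * (2 + \<theta> * real D) \<le> r * real m * real D"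
    and D2: "2 * ln (real m * real D) + (2 * ln A + ln 2 + ln 3) < \<delta> / 2 * real D"
    by (auto simp: eventually_at_top_linorder)
  define \<alpha> where "\<alpha> = nat \<lceil>\<theta> * real d * real D\<rceil>"
  have \<alpha>pos: "\<theta> * real d * real D > 0" using \<theta> d D by simp
  have \<alpha>1: "\<theta> * real d * real D \<le> real \<alpha>" and \<alpha>2: "real \<alpha> \<le> \<theta> * real d * real D + 1"
    using \<alpha>pos unfolding \<alpha>_def by linarith+
  have "\<alpha> > 0" using \<alpha>1 \<alpha>pos by simp
  define N where "N = (m * D) ^ d"
  have N: "N \<ge> 1" using m D by (simp add: N_def)
  define M where "M = (\<Sum>\<beta><\<alpha>. card (degree_indices {..<d} \<beta>))"
  have "real M \<le> (exp 1 * (1 + real \<alpha> / real d)) ^ d"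
    using sum_card_degree_indices_le[of "{..<d}" \<alpha>] d \<open>\<alpha> > 0\<close> by (simp add: M_def lessThan_empty_iff)
  also have "\<dots> \<le> (r * real m * real D) ^ d"
  proof (rule power_mono)
    have "real \<alpha> / real d \<le> (\<theta> * real d * real D + 1) / real d"
      using \<alpha>2 by (rule divide_right_mono) simp
    also have "\<dots> = \<theta> * real D + 1 / real d" using d by (simp add: field_simps)
    also have "\<dots> \<le> \<theta> * real D + 1" using d by simp
    finally have "exp 1 * (1 + real \<alpha> / real d) \<le> exp 1 * (2 + \<theta> * real D)"
      by (intro mult_left_mono) auto
    with D1 show "exp 1 * (1 + real \<alpha> / real d) \<le> r * real m * real D" by linarith
  qed simp
  also have "\<dots> = r ^ d * real N" by (simp add: N_def power_mult_distrib mult_ac)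
  also have "\<dots> \<le> 1 / real (K + 1) * real N" using rd by (rule mult_right_mono) simp
  finally have "real (K + 1) * real M \<le> real N" by (simp add: field_simps)
  then have KM: "(K + 1) * M \<le> N" by (metis of_nat_le_iff of_nat_mult)
  define W where "W = (A * H ^ D) ^ d"
  have W: "W \<ge> 1" unfolding W_def using A H by (metis mult_mono' one_le_power mult_1 zero_le_one)
  define V where "V = 3 * real N * W"
  have NW: "1 * 1 \<le> real N * W" using N W by (intro mult_mono) auto
  then have V: "V \<ge> 1" by (simp add: V_def)
  define v where "v = V powr (1 / real K)"
  have v: "v \<ge> 1" unfolding v_def using V by (intro ge_one_powr_ge_zero) auto
  have vK: "v ^ K = V" unfolding v_def using V K by (simp add: powr_realpow[symmetric] powr_powr)
  \<comment> \<open>B is just above the K-th root of V. Since U is at most V * B, this yields U < B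
    ^ (K + 1), while log B is only about log V / K.\<close>
  define B where "B = nat \<lfloor>v\<rfloor> + 1"
  have B1: "v < real B" and B2: "real B \<le> 2 * v" using v unfolding B_def by linarith+
  have "B \<ge> 2" using v unfolding B_def by (simp add: le_nat_floor)
  have BK: "V < real B ^ K"
    unfolding vK[symmetric] using v B1 K by (intro power_strict_mono) auto
  define U where "U = nat (2 * \<lfloor>real N * real B * W\<rfloor> + 1)"
  have NBW: "1 \<le> real N * real B * W"
  proof -
    have "1 * 1 \<le> (real N * W) * real B" using NW \<open>B \<ge> 2\<close> by (intro mult_mono) auto
    then show ?thesis by (simp add: mult_ac)
  qed
  have U: "real U \<le> V * real B"
  proof -
    have "real U = 2 * real_of_int \<lfloor>real N * real B * W\<rfloor> + 1" using NBW by (simp add: U_def)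
    also have "\<dots> \<le> 3 * (real N * real B * W)" using NBW by linarith
    finally show ?thesis by (simp add: V_def mult_ac)
  qed
  have "U ^ M < B ^ N"
  proof (cases "M = 0")
    case True
    then show ?thesis using N \<open>B \<ge> 2\<close> one_less_power[of B N] by simp
  next
    case False
    have "real U < real B ^ (K + 1)"
    proof -
      have "V * real B < real B ^ K * real B" using BK \<open>B \<ge> 2\<close> by (intro mult_strict_right_mono) auto
      with U show ?thesis by (simp add: mult.commute)
    qed
    then have "U < B ^ (K + 1)" by (metis of_nat_less_iff of_nat_power)
    then have "U ^ M < (B ^ (K + 1)) ^ M" using False by (intro power_strict_mono) auto
    also have "\<dots> = B ^ ((K + 1) * M)" by (rule power_mult[symmetric])
    also have "\<dots> \<le> B ^ N" using KM \<open>B \<ge> 2\<close> by (intro power_increasing) auto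
    finally show ?thesis .
  qed
  then have "\<rho> ^ \<alpha> \<le> real N * real B * W"
    using ineq[OF d D, of B \<alpha>] unfolding U_def M_def N_def W_def by blast
  moreover have "real N * real B * W \<le> real N * (2 * v) * W"
    using B2 W by (intro mult_right_mono mult_left_mono) auto
  ultimately have "\<rho> ^ \<alpha> \<le> real N * (2 * v) * W" by linarith
  then have "ln (\<rho> ^ \<alpha>) \<le> ln (real N * (2 * v) * W)" using \<rho> by (intro ln_mono) auto
  then have "real \<alpha> * L \<le> ln (real N) + ln 2 + ln v + ln W"
    using \<rho> N v W by (simp add: ln_realpow L_def ln_mult)
  moreover have "ln (real N) = real d * ln (real m * real D)"
    using m D by (simp add: N_def ln_realpow)
  moreover have lnW: "ln W = real d * ln A + real d * (real D * \<mu>)"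
    using A H by (simp add: W_def ln_realpow ln_mult \<mu>_def algebra_simps)
  moreover have "ln v = (ln 3 + ln (real N) + ln W) / real K"
    using V N W by (simp add: v_def ln_powr V_def ln_mult)
  moreover have "\<theta> * real d * real D * L \<le> real \<alpha> * L"
    using \<alpha>1 L by (intro mult_right_mono) auto
  ultimately have main: "\<theta> * real d * real D * L \<le> real d * ln (real m * real D) + ln 2
      + (ln 3 + real d * ln (real m * real D) + (real d * ln A + real d * (real D * \<mu>))) / real K
      + (real d * ln A + real d * (real D * \<mu>))" by simp
  define G where "G = ln 3 + real d * ln (real m * real D) + real d * ln A"
  have "1 * 1 \<le> real m * real D" using m D by (intro mult_mono) auto
  then have lnmD: "0 \<le> ln (real m * real D)" by simp
  have "0 \<le> G" unfolding G_def using lnmD A by simp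
  then have "G / real K \<le> G" using K by (simp add: divide_le_eq mult_le_cancel_left1)
  moreover have "real d * (real D * \<mu>) / real K \<le> real d * (real D * (\<delta> / 2))"
    using K\<mu> by (simp add: mult_left_mono flip: times_divide_eq_right)
  moreover have "(ln 3 + real d * ln (real m * real D) + (real d * ln A + real d * (real D * \<mu>))) / real K
      = G / real K + real d * (real D * \<mu>) / real K"
    by (simp add: G_def add_divide_distrib)
  ultimately have "\<theta> * real d * real D * L - real d * (real D * \<mu>)
      \<le> real d * ln (real m * real D) + ln 2 + G + real d * (real D * (\<delta> / 2)) + real d * ln A"
    using main by linarith
  moreover have "\<theta> * real d * real D * L - real d * (real D * \<mu>) = real d * (real D * \<delta>)"
    by (simp add: \<delta>_def algebra_simps)
  ultimately have "real d * (\<delta> / 2 * real D)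
      \<le> real d * (2 * ln (real m * real D) + 2 * ln A) + (ln 2 + ln 3)"
    by (simp add: G_def algebra_simps)
  also have "\<dots> \<le> real d * (2 * ln (real m * real D) + 2 * ln A) + real d * (ln 2 + ln 3)"
    using d mult_right_mono[of 1 "real d" "ln 2 + ln 3"] by simp
  also have "\<dots> = real d * (2 * ln (real m * real D) + (2 * ln A + ln 2 + ln 3))"
    by (simp add: algebra_simps)
  finally have "\<delta> / 2 * real D \<le> 2 * ln (real m * real D) + (2 * ln A + ln 2 + ln 3)"
    using d by (simp only: mult_le_cancel_left_pos of_nat_0_less_iff)
  with D2 show False by simp
qed

section \<open>Rational functions as power series\<close>

lemma ratfun_to_fls_add:
  "ratfun_to_fls (r + s) = ratfun_to_fls r + ratfun_to_fls (s :: 'a::field poly fract)"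
proof -
  obtain a b where r: "r = Fraction_Field.Fract a b" "b \<noteq> 0" by (cases r) auto
  obtain c d where s: "s = Fraction_Field.Fract c d" "d \<noteq> 0" by (cases s) auto
  show ?thesis
    using r s by (simp add: ratfun_to_fls_Fract fps_of_poly_add fps_of_poly_mult
        fls_times_fps_to_fls add_frac_eq)
qed

lemma ratfun_to_fls_mult:
  "ratfun_to_fls (r * s) = ratfun_to_fls r * ratfun_to_fls (s :: 'a::field poly fract)"
proof -
  obtain a b where r: "r = Fraction_Field.Fract a b" "b \<noteq> 0" by (cases r) auto
  obtain c d where s: "s = Fraction_Field.Fract c d" "d \<noteq> 0" by (cases s) auto
  show ?thesis
    using r s by (simp add: ratfun_to_fls_Fract fps_of_poly_mult fls_times_fps_to_fls)
qed

lemma ratfun_to_fls_const: "ratfun_to_fls (ratfun_const c) = fps_to_fls (fps_const c)"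
  by (simp add: ratfun_const_def ratfun_to_fls_Fract fps_of_poly_const)

lemma ratfun_const_0: "ratfun_const 0 = 0"
  by (simp add: ratfun_const_def Zero_fract_def)

lemma ratfun_to_fls_0: "ratfun_to_fls 0 = 0"
  using ratfun_to_fls_const[of 0] by (simp add: ratfun_const_0)

lemma ratfun_to_fls_eq_iff: "ratfun_to_fls r = ratfun_to_fls s \<longleftrightarrow> r = (s :: 'a::field poly fract)"
proof
  assume eq: "ratfun_to_fls r = ratfun_to_fls s"
  obtain a b where r: "r = Fraction_Field.Fract a b" "b \<noteq> 0" by (cases r) auto
  obtain c d where s: "s = Fraction_Field.Fract c d" "d \<noteq> 0" by (cases s) auto
  have "fps_to_fls (fps_of_poly (a * d)) = fps_to_fls (fps_of_poly (c * b))"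
    using eq r s by (simp add: ratfun_to_fls_Fract fps_of_poly_mult fls_times_fps_to_fls frac_eq_eq)
  then have "a * d = c * b" by simp
  then show "r = s" using r s by (simp add: eq_fract)
qed simp

lemma ratfun_to_fls_regular:
  assumes "ratfun_regular_at_0 p"
  shows "ratfun_to_fls p = fps_to_fls (ratfun_to_fps p)"
proof -
  obtain a b where p: "p = Fraction_Field.Fract a b" and b: "poly b 0 \<noteq> 0"
    using assms by (auto simp: ratfun_regular_at_0_def)
  have b0: "fps_nth (fps_of_poly b) 0 \<noteq> 0" "b \<noteq> 0" using b by (auto simp: poly_0_coeff_0)
  then show ?thesis
    by (simp add: p ratfun_to_fps_Fract[OF b] ratfun_to_fls_Fract fls_inverse_fps_to_fls
        fls_times_fps_to_fls divide_inverse fps_divide_unit)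
qed

lemma ratfun_to_fls_poly:
  assumes "ratfun_regular_at_0 p"
  shows "ratfun_to_fls (poly (map_poly ratfun_const A) p)
           = fps_to_fls (poly (map_poly fps_const A) (ratfun_to_fps p))"
  by (induction A)
    (simp_all add: map_poly_pCons ratfun_const_0 ratfun_to_fls_0 ratfun_to_fls_add ratfun_to_fls_mult
      ratfun_to_fls_const ratfun_to_fls_regular[OF assms] fls_times_fps_to_fls)

section \<open>Transcendence of p over the constants and independence of the products\<close>

text \<open>Formal composition requires an inner series without constant term, so the constant term
  \<open>k\<close> is moved into the polynomial.\<close>

lemma poly_fps_shift_eq_compose:
  fixes G :: "'a::idom fps"
  assumes "fps_nth G 0 = 0"
  shows "poly (map_poly fps_const A) (fps_const k + G) = fps_of_poly (pcompose A [:k, 1:]) oo G"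
proof (induction A)
  case (pCons a A)
  have "fps_of_poly [:k, 1:] oo G = fps_const k + G"
    by (simp add: fps_of_poly_pCons fps_compose_add_distrib fps_compose_mult_distrib[OF assms] assms)
  then show ?case
    by (simp add: map_poly_pCons pcompose_pCons fps_of_poly_add fps_of_poly_mult pCons.IH
        fps_compose_add_distrib fps_compose_mult_distrib[OF assms] fps_of_poly_const
        del: fps_of_poly_pCons mult_pCons_left)
qed simp

text \<open>After its constant term is removed, the expansion of a nonconstant p is a nonzero series
  \<open>G\<close>, because expansion at 0 is injective. Composition with such a \<open>G\<close>
  kills no nonzero series.\<close>

lemma ratfun_transcendental:
  fixes p :: "'a::field poly fract"
  assumes "p \<notin> range ratfun_const" "ratfun_regular_at_0 p"
    and "poly (map_poly fps_const A) (ratfun_to_fps p) = 0"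
  shows "A = 0"
proof -
  define k where "k = fps_nth (ratfun_to_fps p) 0"
  define G where "G = ratfun_to_fps p - fps_const k"
  have G0: "fps_nth G 0 = 0" by (simp add: G_def k_def)
  have "G \<noteq> 0"
  proof
    assume "G = 0"
    then have "ratfun_to_fls p = ratfun_to_fls (ratfun_const k)"
      by (simp add: G_def ratfun_to_fls_regular[OF assms(2)] ratfun_to_fls_const)
    with assms(1) show False by (simp add: ratfun_to_fls_eq_iff)
  qed
  moreover have "fps_of_poly (pcompose A [:k, 1:]) oo G = 0"
    using assms(3) poly_fps_shift_eq_compose[OF G0, of A k] by (simp add: G_def)
  ultimately have "pcompose A [:k, 1:] = 0"
    using fps_compose_eq_0_iff[OF G0] by simp
  then show ?thesis using pcompose_eq_0[of A "[:k, 1:]"] by simp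
qed

lemma poly_in_ratfun_subfield: "poly (map_poly ratfun_const A) p \<in> ratfun_subfield p"
proof -
  have "poly (map_poly ratfun_const [:1:]) p = 1"
    by (simp add: map_poly_pCons ratfun_const_0) (simp add: ratfun_const_def One_fract_def one_pCons)
  then show ?thesis
    unfolding ratfun_subfield_def by (intro CollectI exI[of _ A] exI[of _ "[:1:]"]) simp
qed

lemma poly_eq_sum_lessThan:
  fixes q :: "'a::comm_semiring_1 poly"
  assumes "degree q < D"
  shows "poly q x = (\<Sum>k<D. coeff q k * x ^ k)"
  unfolding poly_altdef
  by (rule sum.mono_neutral_left) (use assms in \<open>auto simp: coeff_eq_0\<close>)

lemma fps_to_fls_sum: "fps_to_fls (\<Sum>i\<in>I. g i) = (\<Sum>i\<in>I. fps_to_fls (g i))"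
  by (induction I rule: infinite_finite_induct) auto

text \<open>Grouping a relation by \<open>i\<close> gives coefficients that are polynomials in p,
  hence elements of the subfield generated by p. Independence makes these vanish, and transcendence
  of p then makes each polynomial vanish.\<close>

lemma ratfun_power_products_independent:
  fixes p :: "'a::field poly fract"
  assumes p: "p \<notin> range ratfun_const" "ratfun_regular_at_0 p"
    and indep: "fps_lin_indep_over (ratfun_subfield p) I f"
    and D: "D > 0"
    and zero: "\<And>n. (\<Sum>(i, k)\<in>I \<times> {..<D}. c (i, k) * fps_nth (ratfun_to_fps p ^ k * f i) n) = 0"
  shows "\<forall>j\<in>I \<times> {..<D}. c j = 0"
proof -
  define P where "P = ratfun_to_fps p"
  define A where "A i = Poly (map (\<lambda>k. c (i, k)) [0..<D])" for i
  have coeff_A: "coeff (A i) k = (if k < D then c (i, k) else 0)" for i k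
    by (simp add: A_def nth_default_def)
  have deg: "degree (map_poly fps_const (A i)) < D" for i
  proof -
    have "degree (map_poly fps_const (A i)) \<le> D - 1"
      by (rule degree_le) (use D in \<open>auto simp: coeff_map_poly coeff_A\<close>)
    then show ?thesis using D by simp
  qed
  have poly_A: "poly (map_poly fps_const (A i)) P = (\<Sum>k<D. fps_const (c (i, k)) * P ^ k)" for i
    using poly_eq_sum_lessThan[OF deg, of i P] by (simp add: coeff_map_poly coeff_A)
  define C where "C i = poly (map_poly ratfun_const (A i)) p" for i
  have "(\<Sum>i\<in>I. poly (map_poly fps_const (A i)) P * f i) = 0"
  proof (rule fps_ext)
    fix n
    have "fps_nth (\<Sum>i\<in>I. poly (map_poly fps_const (A i)) P * f i) n
        = (\<Sum>i\<in>I. \<Sum>k<D. c (i, k) * fps_nth (P ^ k * f i) n)"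
      by (simp add: poly_A sum_distrib_right fps_sum_nth mult.assoc)
    also have "\<dots> = 0" using zero[of n] by (simp add: sum.cartesian_product P_def)
    finally show "fps_nth (\<Sum>i\<in>I. poly (map_poly fps_const (A i)) P * f i) n = fps_nth 0 n" by simp
  qed
  then have "(\<Sum>i\<in>I. ratfun_to_fls (C i) * fps_to_fls (f i)) = 0"
    by (simp add: C_def ratfun_to_fls_poly[OF p(2)] P_def flip: fls_times_fps_to_fls fps_to_fls_sum)
  moreover have "\<forall>i\<in>I. C i \<in> ratfun_subfield p" by (simp add: C_def poly_in_ratfun_subfield)
  ultimately have C0: "\<forall>i\<in>I. C i = 0"
    using indep unfolding fps_lin_indep_over_def by blast
  have "A i = 0" if "i \<in> I" for i
  proof (rule ratfun_transcendental[OF p])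
    have "ratfun_to_fls (C i) = 0" using C0 that by (simp add: ratfun_to_fls_0)
    then show "poly (map_poly fps_const (A i)) (ratfun_to_fps p) = 0"
      by (simp add: C_def ratfun_to_fls_poly[OF p(2)])
  qed
  then show ?thesis using coeff_A by (metis SigmaE coeff_0 lessThan_iff)
qed

text \<open>A nontrivial relation between powers of \<open>f\<close> is a nonzero polynomial
  equation for \<open>f\<close> over the rational functions. The shift \<open>j - 1\<close> lets the
  index set start at 1, as in the theorem, while the powers start at 0.\<close>

lemma fps_algebraic_if_powers_dependent:
  fixes f :: "'a::field fps"
  assumes "\<not> fps_lin_indep_over K {1..n} (\<lambda>j. f ^ (j - 1))"
  shows "fps_algebraic f"
proof -
  obtain c where c: "(\<Sum>j\<in>{1..n}. ratfun_to_fls (c j) * fps_to_fls (f ^ (j - 1))) = 0"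
    and ne: "\<exists>j\<in>{1..n}. c j \<noteq> 0"
    using assms unfolding fps_lin_indep_over_def by blast
  define P where "P = Poly (map (\<lambda>k. c (Suc k)) [0..<n])"
  have coeff_P: "coeff P k = (if k < n then c (Suc k) else 0)" for k
    by (simp add: P_def nth_default_def)
  from ne obtain j where j: "j \<in> {1..n}" "c j \<noteq> 0" by blast
  then have "coeff P (j - 1) \<noteq> 0" by (auto simp: coeff_P)
  then have "P \<noteq> 0" by auto
  moreover have "poly (map_poly ratfun_to_fls P) (fps_to_fls f) = 0"
  proof -
    have "degree (map_poly ratfun_to_fls P) \<le> n - 1"
      by (rule degree_le) (use j in \<open>auto simp: coeff_map_poly ratfun_to_fls_0 coeff_P\<close>)
    then have "degree (map_poly ratfun_to_fls P) < n" using j by auto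
    then have "poly (map_poly ratfun_to_fls P) (fps_to_fls f)
        = (\<Sum>k<n. ratfun_to_fls (c (Suc k)) * fps_to_fls (f ^ k))"
      by (simp add: poly_eq_sum_lessThan coeff_map_poly ratfun_to_fls_0 coeff_P fps_to_fls_power)
    also have "\<dots> = 0"
      using c by (simp add: sum.shift_bounds_Suc_ivl atLeastLessThanSuc_atLeastAtMost lessThan_atLeast0
          sum.atLeast1_atMost_eq)
    finally show ?thesis .
  qed
  ultimately show ?thesis unfolding fps_algebraic_def by blast
qed

section \<open>The holonomy bound\<close>

text \<open>Cauchy's inequality on the circle of radius exactly 1, which makes the bound independent
  of \<open>n\<close>. For n = 0 it is the maximum principle at the centre.\<close>

lemma fps_nth_norm_le_of_unit_circle:
  fixes G :: "complex fps"
  assumes G: "fps_conv_radius G > 1"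
    and R: "\<And>z. cmod z = 1 \<Longrightarrow> cmod (eval_fps G z) \<le> R"
  shows "cmod (fps_nth G n) \<le> R"
proof -
  have sub: "cball (0::complex) 1 \<subseteq> eball 0 (fps_conv_radius G)"
  proof
    fix z :: complex assume "z \<in> cball 0 1"
    then have "ereal (cmod z) \<le> 1" by simp
    then have "ereal (cmod z) < fps_conv_radius G" using G by (rule order.strict_trans1)
    then show "z \<in> eball 0 (fps_conv_radius G)" by (simp add: in_eball_iff)
  qed
  have hol: "eval_fps G holomorphic_on cball 0 1" by (rule holomorphic_on_eval_fps[OF sub])
  have "fps_conv_radius G > 0" using G by (rule order.strict_trans[rotated]) simp
  then have "fps_nth G n = (deriv ^^ n) (eval_fps G) 0 / fact n"
    by (intro fps_nth_fps_expansion eval_fps_has_fps_expansion)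
  moreover have "cmod ((deriv ^^ n) (eval_fps G) 0) \<le> fact n * R / 1 ^ n"
    by (rule Cauchy_inequality)
       (use hol R in \<open>auto intro: holomorphic_on_imp_continuous_on holomorphic_on_subset\<close>)
  ultimately show ?thesis by (simp add: norm_divide divide_le_eq mult.commute)
qed

text \<open>By compactness a neighborhood of the closed unit disc contains a larger concentric disc,
  on which the Taylor series converges to \<open>h\<close>.\<close>

lemma analytic_on_cball_fps_expansion:
  assumes "h analytic_on cball 0 1"
  shows "fps_conv_radius (fps_expansion h 0) > 1"
    and "cmod z \<le> 1 \<Longrightarrow> eval_fps (fps_expansion h 0) z = h z"
proof -
  obtain S where S: "open S" "cball 0 1 \<subseteq> S" "h holomorphic_on S"
    using assms by (auto simp: analytic_on_holomorphic)
  obtain \<epsilon> where \<epsilon>: "\<epsilon> > 0" "(\<Union>x\<in>cball 0 1. ball x \<epsilon>) \<subseteq> S"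
    using compact_subset_open_imp_ball_epsilon_subset[OF compact_cball S(1,2)] .
  have "ball 0 (1 + \<epsilon>) \<subseteq> S"
  proof
    fix z :: complex assume z: "z \<in> ball 0 (1 + \<epsilon>)"
    show "z \<in> S"
    proof (cases "cmod z \<le> 1")
      case True
      then show ?thesis using S(2) by auto
    next
      case False
      \<comment> \<open>A point outside the closed disc is compared with its radial projection
        \<open>sgn z\<close> to the unit circle.\<close>
      have "dist (sgn z) z = cmod z - 1"
      proof -
        have "sgn z - z = of_real (1 / cmod z - 1) * z"
          by (simp add: sgn_div_norm scaleR_conv_of_real algebra_simps divide_inverse)
        then have "dist (sgn z) z = \<bar>1 / cmod z - 1\<bar> * cmod z"
          by (simp only: dist_norm norm_mult norm_of_real)
        also have "\<dots> = cmod z - 1" using False by (auto simp: abs_if field_simps)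
        finally show ?thesis .
      qed
      then have "z \<in> ball (sgn z) \<epsilon>" using z by simp
      moreover have "sgn z \<in> cball 0 1" by (simp add: norm_sgn)
      ultimately show ?thesis using \<epsilon>(2) by blast
    qed
  qed
  then have hol: "h holomorphic_on eball 0 (ereal (1 + \<epsilon>))"
    using S(3) by (auto intro: holomorphic_on_subset)
  have "1 < ereal (1 + \<epsilon>)" using \<epsilon>(1) by simp
  also have "\<dots> \<le> fps_conv_radius (fps_expansion h 0)" by (rule conv_radius_fps_expansion[OF hol])
  finally show "fps_conv_radius (fps_expansion h 0) > 1" .
  show "eval_fps (fps_expansion h 0) z = h z" if "cmod z \<le> 1"
    using eval_fps_expansion'[OF hol, of z] that \<epsilon>(1) by simp
qed

section \<open>Multiplicativity of the coefficient conditions, and bounds on the circle\<close>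

lemma fps_complex_of_rat_mult:
  "fps_complex_of_rat (f * g) = fps_complex_of_rat f * fps_complex_of_rat g"
  by (rule fps_ext) (simp add: fps_complex_of_rat_def fps_mult_nth of_rat_sum of_rat_mult)

lemma fps_complex_of_rat_power: "fps_complex_of_rat (f ^ n) = fps_complex_of_rat f ^ n"
proof (induction n)
  case 0
  show ?case by (rule fps_ext) (simp add: fps_complex_of_rat_def)
qed (simp add: fps_complex_of_rat_mult)

lemma fps_int_coeffs_mult: "fps_int_coeffs f \<Longrightarrow> fps_int_coeffs g \<Longrightarrow> fps_int_coeffs (f * g)"
  by (auto simp: fps_int_coeffs_def fps_mult_nth intro!: Ints_sum Ints_mult)

lemma fps_int_coeffs_power: "fps_int_coeffs f \<Longrightarrow> fps_int_coeffs (f ^ n)"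
  by (induction n) (simp_all add: fps_int_coeffs_mult, simp add: fps_int_coeffs_def)

lemma elog_le_iff:
  assumes "0 \<le> r"
  shows "elog r \<le> ereal \<mu> \<longleftrightarrow> r \<le> exp \<mu>"
proof (cases "r = 0")
  case False
  then have "r > 0" using assms by simp
  then have "ln r \<le> \<mu> \<longleftrightarrow> r \<le> exp \<mu>" by (metis exp_le_cancel_iff exp_ln)
  with False show ?thesis by (simp add: elog_def)
qed (simp add: elog_def)

lemma bounded_on_unit_circle:
  assumes "finite I" and "\<And>i. i \<in> I \<Longrightarrow> F i \<in> O_closed_disc"
  obtains A where "A \<ge> 1" and "\<And>i z. i \<in> I \<Longrightarrow> cmod z = 1 \<Longrightarrow> cmod (eval_fps (F i) z) \<le> A"
proof -
  have "compact (eval_fps (F i) ` sphere 0 1)" if "i \<in> I" for i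
  proof (rule compact_continuous_image)
    have "sphere (0::complex) 1 \<subseteq> eball 0 (fps_conv_radius (F i))"
      using assms(2)[OF that] by (auto simp: O_closed_disc_def in_eball_iff one_ereal_def)
    then show "continuous_on (sphere 0 1) (eval_fps (F i))"
      by (intro holomorphic_on_imp_continuous_on holomorphic_on_eval_fps)
  qed simp
  then have "bounded (\<Union>i\<in>I. eval_fps (F i) ` sphere 0 1)"
    using assms(1) by (intro compact_imp_bounded compact_UN) auto
  then obtain A0 where A0: "\<And>y. y \<in> (\<Union>i\<in>I. eval_fps (F i) ` sphere 0 1) \<Longrightarrow> cmod y \<le> A0"
    unfolding bounded_iff by blast
  show ?thesis
  proof (rule that[of "max 1 A0"])
    fix i z assume "i \<in> I" "cmod z = 1"
    then have "cmod (eval_fps (F i) z) \<le> A0" by (intro A0 UN_I imageI) auto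
    then show "cmod (eval_fps (F i) z) \<le> max 1 A0" by simp
  qed simp
qed

text \<open>The general inequalities are applied to the products of powers of p with the
  \<open>f i\<close>, weighted by the D-th power of \<open>h\<close>. The suprema are replaced by a
  real majorant \<open>H\<close>, and \<open>f\<close> and \<open>m\<close> stay arbitrary so that
  powers of a single series can be inserted as well.\<close>

lemma rank_times_ln_derivative_le:
  fixes p :: "rat poly fract" and x :: "rat fps"
    and \<phi> h :: "complex \<Rightarrow> complex" and H :: real
    and m :: nat and f :: "nat \<Rightarrow> rat fps"
  assumes p_nonconst: "p \<notin> range ratfun_const"
    and p_regular: "ratfun_regular_at_0 p"
    and x_0: "fps_nth x 0 = 0" and x_1: "fps_nth x 1 = 1"
    and p_x_integral: "fps_int_coeffs (ratfun_to_fps p oo x)"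
    and \<phi>_0: "\<phi> 0 = 0"
    and \<phi>_deriv: "cmod (deriv \<phi> 0) > 1"
    and p_\<phi>: "formal_comp (ratfun_to_fps p) \<phi> \<in> O_closed_disc"
    and f_indep: "fps_lin_indep_over (ratfun_subfield p) {1..m} f"
    and f_x_integral: "\<And>i. i \<in> {1..m} \<Longrightarrow> fps_int_coeffs (f i oo x)"
    and f_\<phi>: "\<And>i. i \<in> {1..m} \<Longrightarrow> formal_comp (f i) \<phi> \<in> O_closed_disc"
    and h_analytic: "h analytic_on cball 0 1"
    and h_0: "h 0 = 1"
    and H1: "\<And>z. cmod z = 1 \<Longrightarrow> cmod (h z) \<le> H"
    and H2: "\<And>z. cmod z = 1 \<Longrightarrow> cmod (h z * eval_fps (formal_comp (ratfun_to_fps p) \<phi>) z) \<le> H"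
  shows "real m * ln (cmod (deriv \<phi> 0)) \<le> exp 1 * ln H"
proof -
  define \<psi> where "\<psi> = fps_expansion \<phi> 0"
  have \<psi>: "fps_nth \<psi> 0 = 0" "fps_nth \<psi> 1 = deriv \<phi> 0"
    by (simp_all add: \<psi>_def fps_expansion_def \<phi>_0)
  define g where "g = fps_expansion h 0"
  have g_rad: "fps_conv_radius g > 1" and g_eval: "\<And>z. cmod z \<le> 1 \<Longrightarrow> eval_fps g z = h z"
    unfolding g_def using analytic_on_cball_fps_expansion[OF h_analytic] by blast+
  have g0: "fps_nth g 0 = 1" by (simp add: g_def fps_expansion_def h_0)
  \<comment> \<open>The maximum principle together with h(0) = 1.\<close>
  have H: "H \<ge> 1"
    using fps_nth_norm_le_of_unit_circle[OF g_rad, of H 0] H1 g0 by (simp add: g_eval)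
  define P where "P = ratfun_to_fps p"
  define Pz where "Pz = formal_comp P \<phi>"
  obtain A where A: "A \<ge> 1"
    and A_bd: "\<And>i z. i \<in> {1..m} \<Longrightarrow> cmod z = 1 \<Longrightarrow> cmod (eval_fps (formal_comp (f i) \<phi>) z) \<le> A"
    using bounded_on_unit_circle[of "{1..m}" "\<lambda>i. formal_comp (f i) \<phi>"] f_\<phi> by auto
  show ?thesis
  proof (cases "m = 0")
    case True
    then show ?thesis using H by simp
  next
    case False
    show ?thesis
    proof (rule parameter_optimization[OF _ \<phi>_deriv H A])
      show "m > 0" using False by simp
      fix d D \<alpha> B :: nat
      assume d: "d > 0" and D: "D > 0"
        and big: "nat (2 * \<lfloor>real ((m * D) ^ d) * real B * (A * H ^ D) ^ d\<rfloor> + 1)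
          ^ (\<Sum>\<beta><\<alpha>. card (degree_indices {..<d} \<beta>)) < B ^ ((m * D) ^ d)"
      define J where "J = {1..m} \<times> {..<D}"
      define u where "u = (\<lambda>(i, k). P ^ k * f i)"
      have u_z: "fps_complex_of_rat (u (i, k)) oo \<psi> = Pz ^ k * formal_comp (f i) \<phi>" for i k
        by (simp add: u_def fps_complex_of_rat_mult fps_complex_of_rat_power
            fps_compose_mult_distrib[OF \<psi>(1)] fps_compose_power[OF \<psi>(1), symmetric]
            Pz_def formal_comp_def flip: \<psi>_def)
      have R: "cmod (fps_nth (g ^ D * (fps_complex_of_rat (u j) oo \<psi>)) n) \<le> A * H ^ D"
        if j: "j \<in> J" for j n
      proof -
        obtain i k where ik: "j = (i, k)" "i \<in> {1..m}" "k < D" using j by (auto simp: J_def)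
        define F where "F = formal_comp (f i) \<phi>"
        have F_rad: "fps_conv_radius F > 1" using f_\<phi>[OF ik(2)] by (simp add: F_def O_closed_disc_def)
        have P_rad: "fps_conv_radius Pz > 1" using p_\<phi> by (simp add: Pz_def P_def O_closed_disc_def)
        have gD: "fps_conv_radius (g ^ D) > 1" and Pk: "fps_conv_radius (Pz ^ k) > 1"
          using g_rad P_rad fps_conv_radius_power less_le_trans by blast+
        have PF: "fps_conv_radius (Pz ^ k * F) > 1"
          using fps_conv_radius_mult[of "Pz ^ k" F] Pk F_rad by (meson less_le_trans min_less_iff_conj)
        have "cmod (fps_nth (g ^ D * (Pz ^ k * F)) n) \<le> A * H ^ D"
        proof (rule fps_nth_norm_le_of_unit_circle)
          show "fps_conv_radius (g ^ D * (Pz ^ k * F)) > 1"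
            using fps_conv_radius_mult[of "g ^ D" "Pz ^ k * F"] gD PF
            by (meson less_le_trans min_less_iff_conj)
          fix z :: complex assume z: "cmod z = 1"
          have "ereal (cmod z) = 1" using z by simp
          note rad = g_rad[folded this] gD[folded this] Pk[folded this] PF[folded this]
            F_rad[folded this] P_rad[folded this]
          have "eval_fps (g ^ D * (Pz ^ k * F)) z = h z ^ D * (eval_fps Pz z ^ k * eval_fps F z)"
            using z by (simp add: eval_fps_mult[OF rad(2,4)] eval_fps_mult[OF rad(3,5)]
                eval_fps_power[OF rad(1)] eval_fps_power[OF rad(6)] g_eval)
          \<comment> \<open>Of the D factors \<open>h z\<close>, exactly k are paired with the
            factors p(\<phi>(z)); both \<open>h z\<close> and each pair are at most \<open>H\<close>
            in modulus. The constant \<open>A\<close> does not depend on D.\<close>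
          also have "\<dots> = h z ^ (D - k) * (h z * eval_fps Pz z) ^ k * eval_fps F z"
            using ik(3) by (simp add: power_mult_distrib mult_ac flip: power_add)
          finally have "cmod (eval_fps (g ^ D * (Pz ^ k * F)) z)
              = cmod (h z) ^ (D - k) * cmod (h z * eval_fps Pz z) ^ k * cmod (eval_fps F z)"
            by (simp add: norm_mult norm_power)
          also have "\<dots> \<le> H ^ (D - k) * H ^ k * A"
            using H1[OF z] H2[OF z] A_bd[OF ik(2) z] H
            by (intro mult_mono power_mono) (simp_all add: Pz_def P_def F_def)
          also have "\<dots> = A * H ^ D" using ik(3) by (simp flip: power_add)
          finally show "cmod (eval_fps (g ^ D * (Pz ^ k * F)) z) \<le> A * H ^ D" .
        qed
        then show ?thesis by (simp add: ik(1) u_z F_def)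
      qed
      have int: "fps_int_coeffs (u j oo x)" if j: "j \<in> J" for j
      proof -
        obtain i k where ik: "j = (i, k)" "i \<in> {1..m}" using j by (auto simp: J_def)
        then show ?thesis
          using f_x_integral[OF ik(2)] p_x_integral
          by (simp add: u_def fps_compose_mult_distrib[OF x_0] fps_compose_power[OF x_0, symmetric]
              P_def fps_int_coeffs_mult fps_int_coeffs_power)
      qed
      have indep: "\<forall>j\<in>J. c j = 0" if "\<And>n. (\<Sum>j\<in>J. c j * fps_nth (u j) n) = 0" for c
        unfolding J_def
        by (rule ratfun_power_products_independent[OF p_nonconst p_regular f_indep D])
           (use that in \<open>simp add: J_def u_def P_def case_prod_unfold\<close>)
      have cardJ: "card J ^ card {..<d} = (m * D) ^ d" by (simp add: J_def card_cartesian_product)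
      have "cmod (fps_nth \<psi> 1) ^ \<alpha>
          \<le> real (card J ^ card {..<d}) * real B * (A * H ^ D) ^ card {..<d}"
      proof (rule derivative_power_le[OF _ _ indep x_0 x_1 int \<psi>(1) _ _ R])
        show "finite J" by (simp add: J_def)
        show "1 \<le> cmod (fps_nth \<psi> 1)" unfolding \<psi>(2) using \<phi>_deriv by simp
        show "fps_nth (g ^ D) 0 = 1" using g0 by (simp add: fps_nth_power_0)
        show "nat (2 * \<lfloor>real (card J ^ card {..<d}) * real B * (A * H ^ D) ^ card {..<d}\<rfloor> + 1)
            ^ (\<Sum>\<beta><\<alpha>. card (degree_indices {..<d} \<beta>)) < B ^ (card J ^ card {..<d})"
          using big unfolding cardJ by simp
      qed simp_all
      then show "cmod (deriv \<phi> 0) ^ \<alpha> \<le> real ((m * D) ^ d) * real B * (A * H ^ D) ^ d"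
        unfolding cardJ \<psi>(2) by simp
    qed
  qed
qed

theorem theorem2p4:
  fixes p :: "rat poly fract" and x :: "rat fps"
    and \<phi> h :: "complex \<Rightarrow> complex"
    and m :: nat and f :: "nat \<Rightarrow> rat fps"
  assumes p_nonconst: "p \<notin> range ratfun_const"
    and p_regular: "ratfun_regular_at_0 p"
    and x_0: "fps_nth x 0 = 0" and x_1: "fps_nth x 1 = 1"
    and p_x_integral: "fps_int_coeffs (ratfun_to_fps p oo x)"
    and \<phi>_analytic: "\<phi> analytic_on cball 0 1"
    and \<phi>_0: "\<phi> 0 = 0"
    and \<phi>_deriv: "cmod (deriv \<phi> 0) > 1"
    and p_\<phi>: "formal_comp (ratfun_to_fps p) \<phi> \<in> O_closed_disc"
    and f_indep: "fps_lin_indep_over (ratfun_subfield p) {1..m} f"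
    and f_x_integral: "\<And>i. i \<in> {1..m} \<Longrightarrow> fps_int_coeffs (f i oo x)"
    and f_\<phi>: "\<And>i. i \<in> {1..m} \<Longrightarrow> formal_comp (f i) \<phi> \<in> O_closed_disc"
    and h_analytic: "h analytic_on cball 0 1"
    and h_0: "h 0 = 1"
  shows "ereal (real m) \<le>
           ereal (exp 1) *
           max (SUP z\<in>sphere 0 1. elog (cmod (h z)))
               (SUP z\<in>sphere 0 1.
                  elog (cmod (h z * eval_fps (formal_comp (ratfun_to_fps p) \<phi>) z)))
           / ereal (ln (cmod (deriv \<phi> 0)))
         \<and> (\<forall>i\<in>{1..m}. fps_algebraic (f i))"
proof -
  define Pz where "Pz = formal_comp (ratfun_to_fps p) \<phi>"
  define L where "L = ln (cmod (deriv \<phi> 0))"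
  have L: "L > 0" unfolding L_def using \<phi>_deriv by (rule ln_gt_zero)
  define X where "X = max (SUP z\<in>sphere 0 1. elog (cmod (h z)))
               (SUP z\<in>sphere 0 1. elog (cmod (h z * eval_fps Pz z)))"
  \<comment> \<open>Translates bounds on the extended real suprema into pointwise bounds; the value
    -\<infinity> of \<open>elog\<close> at zeros is compatible with this.\<close>
  have X_le_iff: "X \<le> ereal \<mu> \<longleftrightarrow>
      (\<forall>z. cmod z = 1 \<longrightarrow> cmod (h z) \<le> exp \<mu> \<and> cmod (h z * eval_fps Pz z) \<le> exp \<mu>)" for \<mu>
    by (auto simp: X_def SUP_le_iff elog_le_iff)
  define g where "g = fps_expansion h 0"
  have g_rad: "fps_conv_radius g > 1" and g_eval: "\<And>z. cmod z \<le> 1 \<Longrightarrow> eval_fps g z = h z"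
    unfolding g_def using analytic_on_cball_fps_expansion[OF h_analytic] by blast+
  have g0: "fps_nth g 0 = 1" by (simp add: g_def fps_expansion_def h_0)
  \<comment> \<open>A negative \<open>X\<close> would force |h| below 1 on the whole circle, against
    h(0) = 1.\<close>
  have X_ge: "X \<ge> 0"
  proof (rule ccontr)
    assume "\<not> X \<ge> 0"
    then have "X < 0" by simp
    then obtain \<mu> where "X < ereal \<mu>" "ereal \<mu> < 0" using ereal_dense2[of X 0] by blast
    then have "X \<le> ereal \<mu>" "\<mu> < 0" by simp_all
    then have "cmod (fps_nth g 0) \<le> exp \<mu>"
      by (intro fps_nth_norm_le_of_unit_circle[OF g_rad]) (simp add: g_eval X_le_iff)
    then show False using \<open>\<mu> < 0\<close> g0 by simp
  qed
  have "X \<noteq> \<infinity>"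
  proof -
    have "g \<in> O_closed_disc" using g_rad by (simp add: O_closed_disc_def)
    then obtain A1 where A1: "A1 \<ge> 1" "\<And>z. cmod z = 1 \<Longrightarrow> cmod (eval_fps g z) \<le> A1"
      using bounded_on_unit_circle[of "{()}" "\<lambda>_. g"] by auto
    obtain A2 where A2: "A2 \<ge> 1" "\<And>z. cmod z = 1 \<Longrightarrow> cmod (eval_fps Pz z) \<le> A2"
      using bounded_on_unit_circle[of "{()}" "\<lambda>_. Pz"] p_\<phi> unfolding Pz_def by auto
    have "cmod (h z) \<le> A1 * A2 \<and> cmod (h z * eval_fps Pz z) \<le> A1 * A2" if "cmod z = 1" for z
    proof -
      have "cmod (h z) \<le> A1" using A1(2)[OF that] that by (simp add: g_eval)
      then have "cmod (h z) * 1 \<le> A1 * A2" "cmod (h z) * cmod (eval_fps Pz z) \<le> A1 * A2"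
        by (rule mult_mono; use A1(1) A2 that in simp)+
      then show ?thesis by (simp add: norm_mult)
    qed
    moreover have "A1 * A2 > 0" using A1(1) A2(1) by simp
    ultimately have "X \<le> ereal (ln (A1 * A2))" by (simp add: X_le_iff)
    then show ?thesis by auto
  qed
  then obtain \<mu> where \<mu>: "X = ereal \<mu>" using X_ge by (cases X) auto
  then have bd: "\<And>z. cmod z = 1 \<Longrightarrow> cmod (h z) \<le> exp \<mu>"
    "\<And>z. cmod z = 1 \<Longrightarrow> cmod (h z * eval_fps Pz z) \<le> exp \<mu>"
    using X_le_iff[of \<mu>] by auto
  \<comment> \<open>The rank and the family are left open: the bound is used for the given
    \<open>f\<close> and again for powers of one \<open>f i\<close>.\<close>
  note bound = rank_times_ln_derivative_le[OF p_nonconst p_regular x_0 x_1 p_x_integral \<phi>_0 \<phi>_deriv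
      p_\<phi> _ _ _ h_analytic h_0 bd[unfolded Pz_def], folded L_def, unfolded ln_exp]
  have "real m * L \<le> exp 1 * \<mu>" by (rule bound[OF f_indep f_x_integral f_\<phi>])
  then have "real m \<le> exp 1 * \<mu> / L" using L by (simp add: field_simps)
  then have "ereal (real m) \<le> ereal (exp 1) * X / ereal L" using \<mu> L by simp
  moreover have "fps_algebraic (f i)" if i: "i \<in> {1..m}" for i
  proof -
    \<comment> \<open>Any \<open>n\<close> beyond the rank bound makes the first \<open>n\<close>
      powers of \<open>f i\<close> dependent, since they inherit integrality and convergence from
      \<open>f i\<close>.\<close>
    obtain n :: nat where "exp 1 * \<mu> / L < real n" using reals_Archimedean2 by blast
    then have n: "\<not> real n * L \<le> exp 1 * \<mu>" using L by (simp add: field_simps)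
    define \<psi> where "\<psi> = fps_expansion \<phi> 0"
    have \<psi>0: "fps_nth \<psi> 0 = 0" by (simp add: \<psi>_def fps_expansion_def \<phi>_0)
    have "fps_int_coeffs (f i ^ k oo x)" for k
      using fps_int_coeffs_power[OF f_x_integral[OF i]] by (simp add: fps_compose_power[OF x_0])
    moreover have "formal_comp (f i ^ k) \<phi> \<in> O_closed_disc" for k
    proof -
      have "formal_comp (f i ^ k) \<phi> = formal_comp (f i) \<phi> ^ k"
        using fps_compose_power[OF \<psi>0]
        by (simp add: formal_comp_def fps_complex_of_rat_power \<psi>_def)
      then show ?thesis
        using f_\<phi>[OF i] fps_conv_radius_power[of "formal_comp (f i) \<phi>" k]
        by (auto simp: O_closed_disc_def intro: less_le_trans)
    qed
    ultimately have "\<not> fps_lin_indep_over (ratfun_subfield p) {1..n} (\<lambda>j. f i ^ (j - 1))"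
      using bound[of n "\<lambda>j. f i ^ (j - 1)"] n by blast
    then show ?thesis by (rule fps_algebraic_if_powers_dependent)
  qed
  ultimately show ?thesis unfolding X_def Pz_def L_def by blast
qed

end
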